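(* Let $d\ge1$ and let $(G,X)$ be a minimal topological dynamical system. Then the quotient map $\pi_d:(G,X)\to(G,X/\mathbf{NRP}^{[d]}(X))$ is the maximal factor of order at most $d$ of $(G,X)$. That is, $(G,X/\mathbf{NRP}^{[d]}(X))$ is a system of order at most $d$, and if $\phi:(G,X)\to(G,Y)$ is a factor map where $(G,Y)$ is a system of order at most $d$, then there exists a factor map $\psi:(G,X/\mathbf{NRP}^{[d]}(X))\to(G,Y)$ such that $\phi=\psi\circ\pi_d$.
   Context: A topological dynamical system (t.d.s.) $(G,X)$ is a Hausdorff topological group $G$ acting continuously on a compact Hausdorff space $X$; it is minimal if every orbit $Gx$ is dense in $X$. A factor map is a surjective continuous $G$-equivariant map. For $d\ge 0$, $X^{[d]}$ is the set of maps $\{0,1\}^d\to X$ with the product topology, and for $x\in X$, $x^{[d]}\in X^{[d]}$ is the constant map with value $x$. For $h\in G$ and $F\subset\{0,1\}^d$, $[h]_F\in G^{[d]}=G^{\{0,1\}^d}$ is given by $[h]_F(\omega)=h$ if $\omega\in F$ and $[h]_F(\omega)=\mathrm{Id}$ otherwise. A hyperface of $\{0,1\}^d$ is a set $\{\omega:\omega_i=a\}$ with $1\le i\le d$, $a\in\{0,1\}$. The Host-Kra cube group $\mathcal{HK}^{[d]}$ is the subgroup of $G^{[d]}$ generated by all $[h]_F$ with $h\in G$ and $F$ a hyperface. It acts coordinatewise on $X^{[d]}$. The set of dynamical cubes is $C_G^{[d]}(X)=\overline{\{g x^{[d]}: g\in\mathcal{HK}^{[d]},\ x\in X\}}\subset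 X^{[d]}$. For $x,y\in X$, $\llcorner^{[d]}(x,y)\in X^{[d]}$ is the configuration with value $y$ at $\vec 1=(1,\dots,1)$ and value $x$ at all other $\omega\in\{0,1\}^d$. For $d\ge1$, the nilpotent regionally proximal relation of order $d$ is $\mathbf{NRP}^{[d]}(X)=\{(x,y)\in X\times X:\ \llcorner^{[d+1]}(x,y)\in C_G^{[d+1]}(X)\}$. For minimal $(G,X)$ it is a closed $G$-invariant equivalence relation, so $(G,X/\mathbf{NRP}^{[d]}(X))$ is a t.d.s. A t.d.s. $(G,X)$ is a system of order at most $d$ if $\mathbf{NRP}^{[d]}(X)=\Delta=\{(x,x):x\in X\}$. *)

theory Defs
  imports
    "HOL-Analysis.Analysis"
    "HOL-Algebra.Group_Action"
    "HOL-Algebra.Generated_Groups"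
    "HOL-Algebra.Product_Groups"
begin

section \<open>Topological dynamical systems\<close>

locale hausdorff_topological_group = group G
  for G :: "('g, 'm) monoid_scheme" (structure) and T :: "'g topology" +
  assumes topspace_group: "topspace T = carrier G"
    and continuous_mult: "continuous_map (prod_topology T T) T (\<lambda>(g, h). g \<otimes> h)"
    and continuous_inv: "continuous_map T T (\<lambda>g. inv\<^bsub>G\<^esub> g)"
    and Hausdorff_group: "Hausdorff_space T"

locale tds = hausdorff_topological_group G T + group_action G "topspace X" act
  for G :: "('g, 'm) monoid_scheme" (structure) and T :: "'g topology"
    and X :: "'x topology" and act :: "'g \<Rightarrow> 'x \<Rightarrow> 'x" +
  assumes compact: "compact_space X"
    and Hausdorff: "Hausdorff_space X"
    and continuous_action: "continuous_map (prod_topology T X) X (\<lambda>(g, x). act g x)"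

definition minimal_action ::
    "('g, 'm) monoid_scheme \<Rightarrow> 'x topology \<Rightarrow> ('g \<Rightarrow> 'x \<Rightarrow> 'x) \<Rightarrow> bool" where
  "minimal_action G X act \<longleftrightarrow>
     (\<forall>x\<in>topspace X. X closure_of (orbit G act x) = topspace X)"

definition factor_map ::
    "('g, 'm) monoid_scheme \<Rightarrow> 'x topology \<Rightarrow> ('g \<Rightarrow> 'x \<Rightarrow> 'x) \<Rightarrow>
     'y topology \<Rightarrow> ('g \<Rightarrow> 'y \<Rightarrow> 'y) \<Rightarrow> ('x \<Rightarrow> 'y) \<Rightarrow> bool" where
  "factor_map G X actX Y actY f \<longleftrightarrow>
     continuous_map X Y f \<and> f ` topspace X = topspace Y \<and>
     (\<forall>g\<in>carrier G. \<forall>x\<in>topspace X. f (actX g x) = actY g (f x))"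


section \<open>Dynamical cubes\<close>

text \<open>Vertices are functions on the coordinates \<open>1, \<dots>, d\<close>, extended by \<open>undefined\<close>; so are
  configurations, as functions on vertices.\<close>

definition vertices :: "nat \<Rightarrow> (nat \<Rightarrow> nat) set" where
  "vertices d = ({1..d} \<rightarrow>\<^sub>E {0, 1})"

definition hyperfaces :: "nat \<Rightarrow> (nat \<Rightarrow> nat) set set" where
  "hyperfaces d = {{\<omega> \<in> vertices d. \<omega> i = a} | i a. i \<in> {1..d} \<and> a \<in> {0, 1}}"

definition cube_space :: "'x topology \<Rightarrow> nat \<Rightarrow> ((nat \<Rightarrow> nat) \<Rightarrow> 'x) topology" where
  "cube_space X d = product_topology (\<lambda>_. X) (vertices d)"

definition face_element ::
    "('g, 'm) monoid_scheme \<Rightarrow> nat \<Rightarrow> 'g \<Rightarrow> (nat \<Rightarrow> nat) set \<Rightarrow> (nat \<Rightarrow> nat) \<Rightarrow> 'g" where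
  "face_element G d h F = (\<lambda>\<omega>\<in>vertices d. if \<omega> \<in> F then h else \<one>\<^bsub>G\<^esub>)"

definition host_kra_group ::
    "('g, 'm) monoid_scheme \<Rightarrow> nat \<Rightarrow> ((nat \<Rightarrow> nat) \<Rightarrow> 'g) set" where
  "host_kra_group G d =
     generate (product_group (vertices d) (\<lambda>_. G))
       {face_element G d h F | h F. h \<in> carrier G \<and> F \<in> hyperfaces d}"

definition const_config :: "nat \<Rightarrow> 'x \<Rightarrow> (nat \<Rightarrow> nat) \<Rightarrow> 'x" where
  "const_config d x = (\<lambda>\<omega>\<in>vertices d. x)"

definition cube_action ::
    "('g \<Rightarrow> 'x \<Rightarrow> 'x) \<Rightarrow> nat \<Rightarrow> ((nat \<Rightarrow> nat) \<Rightarrow> 'g) \<Rightarrow>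
     ((nat \<Rightarrow> nat) \<Rightarrow> 'x) \<Rightarrow> (nat \<Rightarrow> nat) \<Rightarrow> 'x" where
  "cube_action act d \<gamma> c = (\<lambda>\<omega>\<in>vertices d. act (\<gamma> \<omega>) (c \<omega>))"

definition dynamical_cubes ::
    "('g, 'm) monoid_scheme \<Rightarrow> 'x topology \<Rightarrow> ('g \<Rightarrow> 'x \<Rightarrow> 'x) \<Rightarrow> nat \<Rightarrow>
     ((nat \<Rightarrow> nat) \<Rightarrow> 'x) set" where
  "dynamical_cubes G X act d =
     cube_space X d closure_of
       {cube_action act d \<gamma> (const_config d x) | \<gamma> x. \<gamma> \<in> host_kra_group G d \<and> x \<in> topspace X}"


section \<open>The nilpotent regionally proximal relation\<close>

definition corner_config :: "nat \<Rightarrow> 'x \<Rightarrow> 'x \<Rightarrow> (nat \<Rightarrow> nat) \<Rightarrow> 'x" where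
  "corner_config d x y = (\<lambda>\<omega>\<in>vertices d. if \<omega> = (\<lambda>i\<in>{1..d}. 1) then y else x)"

definition NRP ::
    "('g, 'm) monoid_scheme \<Rightarrow> 'x topology \<Rightarrow> ('g \<Rightarrow> 'x \<Rightarrow> 'x) \<Rightarrow> nat \<Rightarrow> ('x \<times> 'x) set" where
  "NRP G X act d =
     {(x, y) \<in> topspace X \<times> topspace X.
        corner_config (d + 1) x y \<in> dynamical_cubes G X act (d + 1)}"

definition system_of_order_at_most ::
    "('g, 'm) monoid_scheme \<Rightarrow> 'g topology \<Rightarrow> 'x topology \<Rightarrow> ('g \<Rightarrow> 'x \<Rightarrow> 'x) \<Rightarrow> nat \<Rightarrow> bool" where
  "system_of_order_at_most G T X act d \<longleftrightarrow>
     tds G T X act \<and> NRP G X act d = Id_on (topspace X)"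


section \<open>Quotient systems\<close>

definition quotient_topology :: "'x topology \<Rightarrow> ('x \<times> 'x) set \<Rightarrow> 'x set topology" where
  "quotient_topology X R =
     topology (\<lambda>U. U \<subseteq> topspace X // R \<and> openin X {x \<in> topspace X. Equiv_Relations.proj R x \<in> U})"

lemma openin_quotient_topology:
  "openin (quotient_topology X R) U \<longleftrightarrow>
     U \<subseteq> topspace X // R \<and> openin X {x \<in> topspace X. Equiv_Relations.proj R x \<in> U}"
proof -
  let ?P = "\<lambda>x U. Equiv_Relations.proj R x \<in> U"
  have "istopology (\<lambda>U. U \<subseteq> topspace X // R \<and> openin X {x \<in> topspace X. ?P x U})"
    unfolding istopology_def
  proof (intro conjI allI impI)
    fix S U
    assume S: "S \<subseteq> topspace X // R \<and> openin X {x \<in> topspace X. ?P x S}"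
      and U: "U \<subseteq> topspace X // R \<and> openin X {x \<in> topspace X. ?P x U}"
    show "S \<inter> U \<subseteq> topspace X // R" using S by blast
    have "{x \<in> topspace X. ?P x (S \<inter> U)} = {x \<in> topspace X. ?P x S} \<inter> {x \<in> topspace X. ?P x U}"
      by blast
    with S U show "openin X {x \<in> topspace X. ?P x (S \<inter> U)}" by (simp add: openin_Int)
  next
    fix \<K>
    assume K: "\<forall>K\<in>\<K>. K \<subseteq> topspace X // R \<and> openin X {x \<in> topspace X. ?P x K}"
    then show "\<Union>\<K> \<subseteq> topspace X // R" by blast
    have "{x \<in> topspace X. ?P x (\<Union>\<K>)} = (\<Union>K\<in>\<K>. {x \<in> topspace X. ?P x K})" by blast
    moreover have "openin X (\<Union>K\<in>\<K>. {x \<in> topspace X. ?P x K})"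
      using K by (intro openin_Union) auto
    ultimately show "openin X {x \<in> topspace X. ?P x (\<Union>\<K>)}" by simp
  qed
  then show ?thesis unfolding quotient_topology_def by (simp add: topology_inverse')
qed

lemma topspace_quotient_topology: "topspace (quotient_topology X R) = topspace X // R"
proof -
  have "{x \<in> topspace X. Equiv_Relations.proj R x \<in> topspace X // R} = topspace X"
    by (auto simp: proj_preserves)
  then have "openin (quotient_topology X R) (topspace X // R)"
    by (simp add: openin_quotient_topology)
  moreover have "topspace (quotient_topology X R) \<subseteq> topspace X // R"
    using openin_quotient_topology openin_topspace by blast
  ultimately show ?thesis by (meson openin_subset subset_antisym)
qed

lemma quotient_map_proj: "quotient_map X (quotient_topology X R) (Equiv_Relations.proj R)"
  unfolding quotient_map_def topspace_quotient_topology
  by (auto simp: openin_quotient_topology quotient_def proj_def)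

text \<open>The action on classes by \<open>g [x] = g ` [x]\<close>; this is the class of \<open>g x\<close> when the relation
  is an invariant equivalence. The restriction keeps it extensional, as group actions require.\<close>

definition quotient_action ::
    "('g \<Rightarrow> 'x \<Rightarrow> 'x) \<Rightarrow> 'x topology \<Rightarrow> ('x \<times> 'x) set \<Rightarrow> 'g \<Rightarrow> 'x set \<Rightarrow> 'x set" where
  "quotient_action act X R g = (\<lambda>C\<in>topspace X // R. act g ` C)"

lemma quotient_action_proj:
  assumes "group_action G (topspace X) act" "equiv (topspace X) R"
    and inv: "\<And>h u v. h \<in> carrier G \<Longrightarrow> (u, v) \<in> R \<Longrightarrow> (act h u, act h v) \<in> R"
    and g: "g \<in> carrier G" and x: "x \<in> topspace X"
  shows "quotient_action act X R g (Equiv_Relations.proj R x) = Equiv_Relations.proj R (act g x)"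
proof -
  interpret group_action G "topspace X" act by fact
  have R: "R \<subseteq> topspace X \<times> topspace X" using assms(2) by (simp add: equiv_def refl_on_def)
  have G: "inv\<^bsub>G\<^esub> g \<in> carrier G"
    using g group_hom by (simp add: group_hom_def group.inv_closed)
  have "act g ` (R `` {x}) = R `` {act g x}"
  proof
    show "act g ` (R `` {x}) \<subseteq> R `` {act g x}" using inv g by blast
    show "R `` {act g x} \<subseteq> act g ` (R `` {x})"
    proof
      fix z assume "z \<in> R `` {act g x}"
      then have z: "(act g x, z) \<in> R" by simp
      then have zX: "z \<in> topspace X" using R by blast
      have "(act (inv\<^bsub>G\<^esub> g) (act g x), act (inv\<^bsub>G\<^esub> g) z) \<in> R" by (rule inv[OF G z])
      moreover have "act (inv\<^bsub>G\<^esub> g) (act g x) = x"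
        using orbit_sym_aux[OF g x] by blast
      moreover have "act g (act (inv\<^bsub>G\<^esub> g) z) = z"
        using orbit_sym_aux[OF G zX] g group_hom
        by (simp add: group_hom_def group.inv_inv)
      ultimately show "z \<in> act g ` (R `` {x})" by (metis Image_singleton_iff imageI)
    qed
  qed
  then show ?thesis using x by (simp add: quotient_action_def proj_def quotientI)
qed

end

theory Submission
  imports Defs
begin

text \<open>Fix a minimal left ideal \<open>M\<close> of the enveloping semigroup. Call \<open>(y, x)\<close> related if all corners with \<open>y\<close> at
  one vertex and \<open>x\<close> elsewhere are cubes; by reflecting coordinates this is \<open>NRP\<close>. The key point is
  saturation: replacing the values of a cube by related ones yields again a cube after applying an
  idempotent \<open>w \<in> M\<close> to all coordinates. This follows from minimality of \<open>M\<close> together with a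
  semicontinuity argument for the orbit closures of constant configurations under the Host-Kra elements
  that are trivial at one vertex. Moreover an idempotent may be applied to all vertices of a corner but one, and
  since every point is fixed by an idempotent \<open>u \<in> M\<close>, and \<open>u w = u\<close>, this can be undone. Hence the
  relation is an equivalence that contains all pairs \<open>(x, w x)\<close>, and a cube of the quotient, lifted to \<open>X\<close>, can be
  modified within the classes to a corner whenever its image is one. This gives the order of the quotient;
  its maximality is functoriality of \<open>NRP\<close>.\<close>

section \<open>Enveloping semigroups\<close>

lemma openin_Collect_Ball:
  assumes "finite A" "\<And>a. a \<in> A \<Longrightarrow> openin X {x \<in> topspace X. P a x}"
  shows "openin X {x \<in> topspace X. \<forall>a\<in>A. P a x}"
  using assms
proof (induction A)
  case (insert a A)
  have "{x \<in> topspace X. \<forall>a\<in>insert a A. P a x} =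
      {x \<in> topspace X. P a x} \<inter> {x \<in> topspace X. \<forall>a\<in>A. P a x}" by blast
  then show ?case using insert by (simp add: openin_Int)
qed simp

text \<open>Zorn's lemma for closed nonempty sets, with compactness keeping intersections of chains
  nonempty. The property \<open>P\<close> is left abstract so that the result serves for
  subsemigroups as well as for left ideals.\<close>

lemma minimal_closed_subset_exists:
  assumes "compact_space X" and S: "closedin X S" "S \<noteq> {}" "P S"
    and Inter: "\<And>\<C>. \<C> \<noteq> {} \<Longrightarrow> (\<And>A. A \<in> \<C> \<Longrightarrow> P A) \<Longrightarrow> P (\<Inter>\<C>)"
  obtains M where "closedin X M" "M \<noteq> {}" "M \<subseteq> S" "P M"
    "\<And>A. closedin X A \<Longrightarrow> A \<noteq> {} \<Longrightarrow> A \<subseteq> M \<Longrightarrow> P A \<Longrightarrow> A = M"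
proof -
  define \<A> where "\<A> = {A. closedin X A \<and> A \<noteq> {} \<and> A \<subseteq> S \<and> P A}"
  have SA: "S \<in> \<A>" using S by (simp add: \<A>_def)
  have sub: "A \<subseteq> topspace X" if "A \<in> \<A>" for A
    using that closedin_subset unfolding \<A>_def by blast
  \<comment> \<open>\<open>subset_Zorn_nonempty\<close> produces maximal sets, so it is applied to
    complements: a maximal complement belongs to a minimal set.\<close>
  have "\<exists>M\<in>(\<lambda>A. topspace X - A) ` \<A>. \<forall>B\<in>(\<lambda>A. topspace X - A) ` \<A>. M \<subseteq> B \<longrightarrow> B = M"
  proof (rule subset_Zorn_nonempty)
    show "(\<lambda>A. topspace X - A) ` \<A> \<noteq> {}" using SA by blast
    fix \<C> assume ne: "\<C> \<noteq> {}" and ch: "subset.chain ((\<lambda>A. topspace X - A) ` \<A>) \<C>"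
    have chain: "B \<subseteq> B' \<or> B' \<subseteq> B" if "B \<in> \<C>" "B' \<in> \<C>" for B B'
      using ch that unfolding subset.chain_def by blast
    have "\<C> \<subseteq> (\<lambda>A. topspace X - A) ` \<A>" using ch unfolding subset.chain_def by blast
    then obtain \<D> where \<D>: "\<D> \<subseteq> \<A>" "\<C> = (\<lambda>A. topspace X - A) ` \<D>"
      by (meson subset_imageE)
    have \<D>ne: "\<D> \<noteq> {}" using ne \<D> by blast
    have chD: "A \<subseteq> A' \<or> A' \<subseteq> A" if "A \<in> \<D>" "A' \<in> \<D>" for A A'
      using chain[of "topspace X - A" "topspace X - A'"] that \<D> sub by blast
    \<comment> \<open>A finite nonempty subfamily of a chain has its own intersection as a member.
      This gives the finite intersection property.\<close>
    have fin: "\<F> \<noteq> {} \<longrightarrow> \<Inter>\<F> \<in> \<D>" if "finite \<F>" "\<F> \<subseteq> \<D>" for \<F>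
      using that
    proof (induction \<F>)
      case (insert A \<F>)
      show ?case
      proof (cases "\<F> = {}")
        case False
        then have "\<Inter>\<F> \<in> \<D>" "A \<in> \<D>" using insert by auto
        then have "A \<inter> \<Inter>\<F> \<in> \<D>" using chD[of A "\<Inter>\<F>"] by (metis inf.absorb1 inf.absorb2)
        then show ?thesis by simp
      qed (use insert in auto)
    qed simp
    have "\<Inter>\<F> \<noteq> {}" if "finite \<F>" "\<F> \<subseteq> \<D>" for \<F>
    proof (cases "\<F> = {}")
      case False
      then have "\<Inter>\<F> \<in> \<A>" using fin that \<D> by blast
      then show ?thesis by (simp add: \<A>_def)
    qed simp
    moreover have "\<forall>A\<in>\<D>. closedin X A" using \<D> by (auto simp: \<A>_def)
    ultimately have "\<Inter>\<D> \<noteq> {}"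
      using \<open>compact_space X\<close>[unfolded compact_space_fip, rule_format, of \<D>] by simp
    moreover have "closedin X (\<Inter>\<D>)" using \<D> \<D>ne by (intro closedin_Inter) (auto simp: \<A>_def)
    moreover have "\<Inter>\<D> \<subseteq> S" using \<D> \<D>ne by (auto simp: \<A>_def)
    moreover have "P (\<Inter>\<D>)" using \<D> by (intro Inter \<D>ne) (auto simp: \<A>_def)
    ultimately have "\<Inter>\<D> \<in> \<A>" by (simp add: \<A>_def)
    moreover have "\<Union>\<C> = topspace X - \<Inter>\<D>" using \<D> by blast
    ultimately show "\<Union>\<C> \<in> (\<lambda>A. topspace X - A) ` \<A>" by blast
  qed
  then obtain M where M: "M \<in> \<A>"
    and max: "\<And>A. A \<in> \<A> \<Longrightarrow> topspace X - M \<subseteq> topspace X - A \<Longrightarrow> topspace X - A = topspace X - M"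
    by auto
  show thesis
  proof (rule that[of M])
    fix A assume A: "closedin X A" "A \<noteq> {}" "A \<subseteq> M" "P A"
    then have "A \<in> \<A>" using M by (auto simp: \<A>_def)
    then have "topspace X - A = topspace X - M" using max A by blast
    then show "A = M" using sub[OF M] sub[OF \<open>A \<in> \<A>\<close>] by blast
  qed (use M in \<open>auto simp: \<A>_def\<close>)
qed

text \<open>The space X^X. Its points are extensional maps, so composition is written
  \<open>compose (topspace X)\<close> throughout, which keeps results extensional.\<close>

definition pointwise_topology :: "'x topology \<Rightarrow> ('x \<Rightarrow> 'x) topology" where
  "pointwise_topology X = product_topology (\<lambda>_. X) (topspace X)"

lemma topspace_pointwise_topology: "topspace (pointwise_topology X) = topspace X \<rightarrow>\<^sub>E topspace X"
  by (simp add: pointwise_topology_def)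

lemma compact_space_pointwise_topology: "compact_space X \<Longrightarrow> compact_space (pointwise_topology X)"
  by (simp add: pointwise_topology_def compact_space_product_topology)

lemma Hausdorff_space_pointwise_topology: "Hausdorff_space X \<Longrightarrow> Hausdorff_space (pointwise_topology X)"
  by (simp add: pointwise_topology_def Hausdorff_space_product_topology)

lemma continuous_map_eval_pointwise:
  "x \<in> topspace X \<Longrightarrow> continuous_map (pointwise_topology X) X (\<lambda>p. p x)"
  unfolding pointwise_topology_def by (rule continuous_map_product_projection)

lemma continuous_map_into_pointwise:
  assumes "\<And>y. y \<in> topspace Y \<Longrightarrow> f y \<in> extensional (topspace X)"
    and "\<And>x. x \<in> topspace X \<Longrightarrow> continuous_map Y X (\<lambda>y. f y x)"
  shows "continuous_map Y (pointwise_topology X) f"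
  unfolding pointwise_topology_def continuous_map_componentwise using assms by auto

text \<open>Evaluating the composite at \<open>x\<close> is evaluating \<open>p\<close> at
  \<open>q x\<close>, which is a coordinate projection. Hence X^X is a right topological
  semigroup.\<close>

lemma continuous_map_compose_right:
  assumes "q \<in> topspace X \<rightarrow> topspace X"
  shows "continuous_map (pointwise_topology X) (pointwise_topology X) (\<lambda>p. compose (topspace X) p q)"
proof (rule continuous_map_into_pointwise)
  fix x assume x: "x \<in> topspace X"
  then have "continuous_map (pointwise_topology X) X (\<lambda>p. p (q x))"
    using assms by (intro continuous_map_eval_pointwise) auto
  then show "continuous_map (pointwise_topology X) X (\<lambda>p. compose (topspace X) p q x)"
    using x by (simp add: compose_def)
qed auto

lemma continuous_map_compose_left:
  assumes "continuous_map X X f"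
  shows "continuous_map (pointwise_topology X) (pointwise_topology X) (\<lambda>p. compose (topspace X) f p)"
proof (rule continuous_map_into_pointwise)
  fix x assume x: "x \<in> topspace X"
  have "continuous_map (pointwise_topology X) X (f \<circ> (\<lambda>p. p x))"
    using continuous_map_eval_pointwise[OF x] assms by (rule continuous_map_compose)
  then show "continuous_map (pointwise_topology X) X (\<lambda>p. compose (topspace X) f p x)"
    using x by (simp add: compose_def o_def)
qed auto

text \<open>Take a minimal closed subsemigroup \<open>A\<close> and any \<open>u\<close> in it. Then
  \<open>A u\<close> is a closed subsemigroup of \<open>A\<close>, so it equals \<open>A\<close> and
  some \<open>p\<close> satisfies \<open>p u = u\<close>. The elements with this property form a
  closed subsemigroup as well, so they exhaust \<open>A\<close> and include
  \<open>u\<close>.\<close>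

theorem Ellis_Numakura:
  assumes X: "compact_space X" "Hausdorff_space X"
    and S: "closedin (pointwise_topology X) S" "S \<noteq> {}"
    and comp: "\<And>p q. p \<in> S \<Longrightarrow> q \<in> S \<Longrightarrow> compose (topspace X) p q \<in> S"
  obtains u where "u \<in> S" "compose (topspace X) u u = u"
proof -
  let ?\<Omega> = "pointwise_topology X" and ?c = "compose (topspace X)"
  define P where "P A \<longleftrightarrow> (\<forall>p\<in>A. \<forall>q\<in>A. ?c p q \<in> A)" for A
  have cpt: "compact_space ?\<Omega>" and Hd: "Hausdorff_space ?\<Omega>"
    using X by (simp_all add: compact_space_pointwise_topology Hausdorff_space_pointwise_topology)
  obtain A where A: "closedin ?\<Omega> A" "A \<noteq> {}" "A \<subseteq> S" "P A"
    and min: "\<And>B. closedin ?\<Omega> B \<Longrightarrow> B \<noteq> {} \<Longrightarrow> B \<subseteq> A \<Longrightarrow> P B \<Longrightarrow> B = A"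
  proof (rule minimal_closed_subset_exists[OF cpt S, of P])
    show "P S" using comp by (simp add: P_def)
    show "P (\<Inter>\<C>)" if "\<And>A. A \<in> \<C> \<Longrightarrow> P A" for \<C>
      using that unfolding P_def by blast
  qed (rule that; assumption)
  have maps: "p \<in> topspace X \<rightarrow>\<^sub>E topspace X" if "p \<in> A" for p
    using subsetD[OF closedin_subset[OF A(1)] that] by (simp add: topspace_pointwise_topology)
  obtain u where u: "u \<in> A" using A by blast
  have assoc: "?c p (?c q r) = ?c (?c p q) r" if "r \<in> A" for p q r
    using compose_assoc[of r "topspace X" "topspace X" p q] maps[OF that] by auto
  have cont: "continuous_map ?\<Omega> ?\<Omega> (\<lambda>p. ?c p u)"
    using maps[OF u] by (intro continuous_map_compose_right) auto
  have "(\<lambda>p. ?c p u) ` A = A"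
  proof (rule min)
    show "closedin ?\<Omega> ((\<lambda>p. ?c p u) ` A)"
      by (rule compactin_imp_closedin[OF Hd image_compactin[OF closedin_compact_space[OF cpt A(1)] cont]])
    show "P ((\<lambda>p. ?c p u) ` A)"
      unfolding P_def
    proof (intro ballI)
      fix a b assume "a \<in> (\<lambda>p. ?c p u) ` A" "b \<in> (\<lambda>p. ?c p u) ` A"
      then obtain p q where pq: "p \<in> A" "q \<in> A" "a = ?c p u" "b = ?c q u" by blast
      have "?c a b = ?c (?c (?c p u) q) u" using pq assoc[OF u] by simp
      then show "?c a b \<in> (\<lambda>p. ?c p u) ` A" using pq u A(4) by (auto simp: P_def)
    qed
  qed (use A u in \<open>auto simp: P_def\<close>)
  then obtain p where p: "p \<in> A" "?c p u = u" using u by (metis imageE)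
  have "{q \<in> A. ?c q u \<in> {u}} = A"
  proof (rule min)
    have "closedin ?\<Omega> {u}"
      using Hd u A(1) by (meson closedin_Hausdorff_singleton closedin_subset subsetD)
    then show "closedin ?\<Omega> {q \<in> A. ?c q u \<in> {u}}"
      by (rule closedin_continuous_map_preimage_gen[OF cont A(1)])
    show "P {q \<in> A. ?c q u \<in> {u}}" using A(4) u by (auto simp: P_def assoc[symmetric])
  qed (use p in auto)
  then have "?c u u = u" using u by blast
  then show thesis using that u A by blast
qed

section \<open>The enveloping semigroup of a system and its minimal left ideals\<close>

context tds
begin

lemma act_closed: "g \<in> carrier G \<Longrightarrow> x \<in> topspace X \<Longrightarrow> act g x \<in> topspace X"
  using element_image by blast

lemma act_one: "x \<in> topspace X \<Longrightarrow> act \<one> x = x"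
  using id_eq_one by (metis restrict_apply')

lemma act_PiE: "g \<in> carrier G \<Longrightarrow> act g \<in> topspace X \<rightarrow>\<^sub>E topspace X"
  using bij_prop0[of g] act_closed by (auto simp: Bij_def PiE_iff)

lemma continuous_map_act:
  assumes "g \<in> carrier G"
  shows "continuous_map X X (act g)"
proof -
  have "continuous_map X (prod_topology T X) (\<lambda>x. (g, x))"
    using assms by (intro continuous_map_pairedI) (auto simp: topspace_group)
  from continuous_map_compose[OF this continuous_action] show ?thesis by (simp add: o_def)
qed

text \<open>Only the translations are tested. For a closed subset of the enveloping semigroup this
  amounts to being a left ideal, because the translations are dense and \<open>p q\<close> is
  continuous in \<open>p\<close>.\<close>

definition invariant_maps :: "('x \<Rightarrow> 'x) set \<Rightarrow> bool" where
  "invariant_maps A \<longleftrightarrow> (\<forall>g\<in>carrier G. \<forall>q\<in>A. compose (topspace X) (act g) q \<in> A)"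

definition enveloping :: "('x \<Rightarrow> 'x) set" where
  "enveloping = pointwise_topology X closure_of (act ` carrier G)"

definition minimal_left_ideal :: "('x \<Rightarrow> 'x) set \<Rightarrow> bool" where
  "minimal_left_ideal M \<longleftrightarrow>
     closedin (pointwise_topology X) M \<and> M \<noteq> {} \<and> M \<subseteq> enveloping \<and> invariant_maps M \<and>
     (\<forall>A. closedin (pointwise_topology X) A \<and> A \<noteq> {} \<and> A \<subseteq> M \<and> invariant_maps A \<longrightarrow> A = M)"

lemma act_in_enveloping: "g \<in> carrier G \<Longrightarrow> act g \<in> enveloping"
proof -
  assume g: "g \<in> carrier G"
  have "act ` carrier G \<subseteq> topspace (pointwise_topology X)"
    using act_PiE by (auto simp: topspace_pointwise_topology)
  from closure_of_subset[OF this] show ?thesis using g by (auto simp: enveloping_def)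
qed

text \<open>Left composition with a translation is continuous and permutes the translations, so it
  maps their closure into itself.\<close>

lemma invariant_enveloping: "invariant_maps enveloping"
  unfolding invariant_maps_def
proof (intro ballI)
  fix g q assume g: "g \<in> carrier G" and q: "q \<in> enveloping"
  have "compose (topspace X) (act g) (act h) = act (g \<otimes> h)" if "h \<in> carrier G" for h
  proof
    fix x
    show "compose (topspace X) (act g) (act h) x = act (g \<otimes> h) x"
      using that g composition_rule[of x g h] PiE_arb[OF act_PiE[of "g \<otimes> h"], of x]
      by (simp add: compose_def)
  qed
  then have "compose (topspace X) (act g) ` act ` carrier G \<subseteq> act ` carrier G"
    using g by auto
  from order_trans[OF continuous_map_image_closure_subset
      [OF continuous_map_compose_left[OF continuous_map_act[OF g]]] closure_of_mono[OF this]]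
  have "compose (topspace X) (act g) ` enveloping \<subseteq> enveloping" unfolding enveloping_def .
  then show "compose (topspace X) (act g) q \<in> enveloping" using q by (rule subsetD[OF _ imageI])
qed

lemma minimal_left_ideal_exists: "\<exists>M. minimal_left_ideal M"
proof -
  let ?\<Omega> = "pointwise_topology X"
  have cl: "closedin ?\<Omega> enveloping" by (simp add: enveloping_def)
  have ne: "enveloping \<noteq> {}" using act_in_enveloping[OF one_closed] by blast
  have Int: "invariant_maps (\<Inter>\<C>)" if "\<And>A. A \<in> \<C> \<Longrightarrow> invariant_maps A" for \<C>
    unfolding invariant_maps_def by (intro ballI InterI) (use that in \<open>simp add: invariant_maps_def\<close>)
  obtain M where "closedin ?\<Omega> M" "M \<noteq> {}" "M \<subseteq> enveloping" "invariant_maps M"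
    "\<And>A. closedin ?\<Omega> A \<Longrightarrow> A \<noteq> {} \<Longrightarrow> A \<subseteq> M \<Longrightarrow> invariant_maps A \<Longrightarrow> A = M"
    by (rule minimal_closed_subset_exists
        [OF compact_space_pointwise_topology[OF compact] cl ne, of invariant_maps])
      (rule invariant_enveloping Int that; assumption)+
  then show ?thesis unfolding minimal_left_ideal_def by blast
qed

end

text \<open>The ideal is a parameter, so that all arguments share one choice of \<open>M\<close>.
  Statements about \<open>NRP\<close> do not mention it, and
  \<open>minimal_left_ideal_exists\<close> supplies it in the end.\<close>

locale minimal_tds = tds G T X act
  for G :: "('g, 'm) monoid_scheme" (structure) and T :: "'g topology"
    and X :: "'x topology" and act :: "'g \<Rightarrow> 'x \<Rightarrow> 'x" +
  fixes M :: "('x \<Rightarrow> 'x) set"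
  assumes minimal: "minimal_action G X act"
    and ideal: "minimal_left_ideal M"
begin

section \<open>Composition, evaluation and idempotents in a minimal left ideal\<close>

lemma ideal_closed: "closedin (pointwise_topology X) M"
  and ideal_nonempty: "M \<noteq> {}"
  and ideal_sub: "M \<subseteq> enveloping"
  and ideal_invariant: "g \<in> carrier G \<Longrightarrow> q \<in> M \<Longrightarrow> compose (topspace X) (act g) q \<in> M"
  and ideal_minimal: "closedin (pointwise_topology X) A \<Longrightarrow> A \<noteq> {} \<Longrightarrow> A \<subseteq> M \<Longrightarrow>
    (\<And>g q. g \<in> carrier G \<Longrightarrow> q \<in> A \<Longrightarrow> compose (topspace X) (act g) q \<in> A) \<Longrightarrow> A = M"
  using ideal unfolding minimal_left_ideal_def invariant_maps_def by blast+

lemma ideal_PiE: "q \<in> M \<Longrightarrow> q \<in> topspace X \<rightarrow>\<^sub>E topspace X"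
  using subsetD[OF closedin_subset[OF ideal_closed]] by (simp add: topspace_pointwise_topology)

lemma ideal_maps: "q \<in> M \<Longrightarrow> x \<in> topspace X \<Longrightarrow> q x \<in> topspace X"
  using ideal_PiE by blast

lemma compactin_ideal: "compactin (pointwise_topology X) M"
  using closedin_compact_space[OF compact_space_pointwise_topology[OF compact] ideal_closed] .

text \<open>\<open>p\<close> is a limit of translations and \<open>p q\<close> depends continuously
  on \<open>p\<close>, so \<open>p q\<close> is a limit of elements of the closed set
  \<open>M\<close>.\<close>

lemma enveloping_compose_ideal:
  assumes "p \<in> enveloping" "q \<in> M"
  shows "compose (topspace X) p q \<in> M"
proof -
  let ?f = "\<lambda>p. compose (topspace X) p q"
  have "continuous_map (pointwise_topology X) (pointwise_topology X) ?f"
    using ideal_PiE[OF assms(2)] by (intro continuous_map_compose_right) auto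
  from continuous_map_image_closure_subset[OF this]
  have "?f p \<in> pointwise_topology X closure_of (?f ` act ` carrier G)"
    using assms(1) unfolding enveloping_def by (rule subsetD[OF _ imageI])
  also have "\<dots> \<subseteq> pointwise_topology X closure_of M"
    using ideal_invariant assms(2) by (intro closure_of_mono) auto
  also have "\<dots> = M" using ideal_closed by (simp add: closure_of_closedin)
  finally show ?thesis .
qed

lemma ideal_compose: "p \<in> M \<Longrightarrow> q \<in> M \<Longrightarrow> compose (topspace X) p q \<in> M"
  using enveloping_compose_ideal ideal_sub by blast

lemma invariant_closed_eq_topspace:
  assumes "closedin X A" "A \<noteq> {}" "\<And>g x. g \<in> carrier G \<Longrightarrow> x \<in> A \<Longrightarrow> act g x \<in> A"
  shows "A = topspace X"
proof
  show "A \<subseteq> topspace X" using assms(1) by (rule closedin_subset)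
  obtain a where a: "a \<in> A" using assms(2) by blast
  then have "topspace X = X closure_of (orbit G act a)"
    using minimal \<open>A \<subseteq> topspace X\<close> unfolding minimal_action_def by blast
  also have "\<dots> \<subseteq> A"
    using assms a by (intro closure_of_minimal) (auto simp: orbit_def)
  finally show "topspace X \<subseteq> A" .
qed

text \<open>The values at \<open>x\<close> of the maps in \<open>M\<close> form a compact, hence
  closed, invariant set, which is all of \<open>X\<close> by minimality of the action.\<close>

lemma ideal_eval_onto:
  assumes "x \<in> topspace X" "y \<in> topspace X"
  obtains q where "q \<in> M" "q x = y"
proof -
  have "(\<lambda>q. q x) ` M = topspace X"
  proof (rule invariant_closed_eq_topspace)
    show "closedin X ((\<lambda>q. q x) ` M)"
      by (rule compactin_imp_closedin[OF Hausdorff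
            image_compactin[OF compactin_ideal continuous_map_eval_pointwise[OF assms(1)]]])
    fix g y assume g: "g \<in> carrier G" and "y \<in> (\<lambda>q. q x) ` M"
    then obtain q where q: "q \<in> M" "y = q x" by blast
    then have "act g y = compose (topspace X) (act g) q x" using assms by (simp add: compose_def)
    then show "act g y \<in> (\<lambda>q. q x) ` M" using ideal_invariant[OF g q(1)] by blast
  qed (use ideal_nonempty in auto)
  then show thesis using that assms(2) by (metis imageE)
qed

definition idempotents :: "('x \<Rightarrow> 'x) set" where
  "idempotents = {u \<in> M. compose (topspace X) u u = u}"

text \<open>The elements of \<open>M\<close> that fix \<open>x\<close> form a closed subsemigroup,
  nonempty by \<open>ideal_eval_onto\<close>. Its idempotent comes from
  \<open>Ellis_Numakura\<close>.\<close>

lemma idempotent_fixing: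
  assumes x: "x \<in> topspace X"
  obtains u where "u \<in> idempotents" "u x = x"
proof -
  let ?S = "{q \<in> M. q x \<in> {x}}"
  have "closedin (pointwise_topology X) ?S"
    using closedin_Hausdorff_singleton[OF Hausdorff x]
    by (intro closedin_continuous_map_preimage_gen[OF continuous_map_eval_pointwise[OF x] ideal_closed])
  moreover have "?S \<noteq> {}" using ideal_eval_onto[OF x x] by blast
  moreover have "compose (topspace X) p q \<in> ?S" if "p \<in> ?S" "q \<in> ?S" for p q
    using that ideal_compose[of p q] x by (simp add: compose_def)
  ultimately obtain u where "u \<in> ?S" "compose (topspace X) u u = u"
    using Ellis_Numakura[OF compact Hausdorff, of ?S] by blast
  then show thesis using that[of u] by (simp add: idempotents_def)
qed

lemma idempotent_twice: "u \<in> idempotents \<Longrightarrow> x \<in> topspace X \<Longrightarrow> u (u x) = u x"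
  unfolding idempotents_def by (metis (mono_tags, lifting) compose_eq mem_Collect_eq)

text \<open>\<open>M w\<close> is a closed left ideal contained in \<open>M\<close>, so \<open>u = p w\<close> for some \<open>p\<close>.\<close>

lemma idempotent_absorb:
  assumes u: "u \<in> M" and w: "w \<in> idempotents" and x: "x \<in> topspace X"
  shows "u (w x) = u x"
proof -
  have wM: "w \<in> M" using w by (simp add: idempotents_def)
  have wf: "w \<in> topspace X \<rightarrow> topspace X" using ideal_maps[OF wM] by blast
  have "(\<lambda>p. compose (topspace X) p w) ` M = M"
  proof (rule ideal_minimal)
    show "closedin (pointwise_topology X) ((\<lambda>p. compose (topspace X) p w) ` M)"
      by (rule compactin_imp_closedin[OF Hausdorff_space_pointwise_topology[OF Hausdorff]
            image_compactin[OF compactin_ideal continuous_map_compose_right[OF wf]]])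
    show "(\<lambda>p. compose (topspace X) p w) ` M \<subseteq> M" using ideal_compose wM by blast
    fix g q assume g: "g \<in> carrier G" and "q \<in> (\<lambda>p. compose (topspace X) p w) ` M"
    then obtain p where p: "p \<in> M" "q = compose (topspace X) p w" by blast
    have "compose (topspace X) (act g) q = compose (topspace X) (compose (topspace X) (act g) p) w"
      using compose_assoc[of w "topspace X" "topspace X" "act g" p] wf p by simp
    then show "compose (topspace X) (act g) q \<in> (\<lambda>p. compose (topspace X) p w) ` M"
      using ideal_invariant[OF g p(1)] by blast
  qed (use ideal_nonempty in auto)
  then obtain p where "p \<in> M" "u = compose (topspace X) p w" using u by (metis imageE)
  then show ?thesis using x ideal_maps[OF wM] idempotent_twice[OF w x] by (simp add: compose_def)
qed

end

section \<open>Cubes and the Host-Kra group\<close>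

lemma finite_vertices: "finite (vertices k)"
  by (simp add: vertices_def finite_PiE)

lemma vertices_coord: "\<omega> \<in> vertices k \<Longrightarrow> i \<in> {1..k} \<Longrightarrow> \<omega> i = 0 \<or> \<omega> i = 1"
  unfolding vertices_def by (metis PiE_mem empty_iff insert_iff)

lemma vertices_eqI:
  "\<omega> \<in> vertices k \<Longrightarrow> \<alpha> \<in> vertices k \<Longrightarrow> (\<And>i. i \<in> {1..k} \<Longrightarrow> \<omega> i = \<alpha> i) \<Longrightarrow> \<omega> = \<alpha>"
  unfolding vertices_def by (rule PiE_ext)

lemma topspace_cube_space: "topspace (cube_space X k) = vertices k \<rightarrow>\<^sub>E topspace X"
  by (simp add: cube_space_def)

lemma compact_space_cube_space: "compact_space X \<Longrightarrow> compact_space (cube_space X k)"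
  by (simp add: cube_space_def compact_space_product_topology)

lemma Hausdorff_space_cube_space: "Hausdorff_space X \<Longrightarrow> Hausdorff_space (cube_space X k)"
  by (simp add: cube_space_def Hausdorff_space_product_topology)

lemma continuous_map_cube_coordinate:
  "\<omega> \<in> vertices k \<Longrightarrow> continuous_map (cube_space X k) X (\<lambda>c. c \<omega>)"
  unfolding cube_space_def by (rule continuous_map_product_projection)

lemma continuous_map_into_cube_space:
  assumes "\<And>\<omega>. \<omega> \<in> vertices k \<Longrightarrow> continuous_map Y X (\<lambda>y. f y \<omega>)"
  shows "continuous_map Y (cube_space X k) (\<lambda>y. \<lambda>\<omega>\<in>vertices k. f y \<omega>)"
  unfolding cube_space_def continuous_map_componentwise using assms by auto

lemma closedin_dynamical_cubes: "closedin (cube_space X k) (dynamical_cubes G X act k)"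
  by (simp add: dynamical_cubes_def)

lemma dynamical_cubes_subset: "dynamical_cubes G X act k \<subseteq> topspace (cube_space X k)"
  by (rule closedin_subset[OF closedin_dynamical_cubes])

lemma cube_coordinate:
  "c \<in> dynamical_cubes G X act k \<Longrightarrow> \<omega> \<in> vertices k \<Longrightarrow> c \<omega> \<in> topspace X"
  using subsetD[OF dynamical_cubes_subset] by (metis PiE_mem topspace_cube_space)

lemma cube_restrict:
  assumes "c \<in> dynamical_cubes G X act k"
  shows "(\<lambda>\<omega>\<in>vertices k. c \<omega>) = c"
  using subsetD[OF dynamical_cubes_subset assms]
  unfolding topspace_cube_space by (rule PiE_restrict)

text \<open>The symmetry that flips the coordinates at which \<alpha> is not 1. It is an involution
  of the vertices and exchanges \<alpha> with the all-ones vertex, where \<open>NRP\<close> puts the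
  exceptional value.\<close>

definition reflect :: "nat \<Rightarrow> (nat \<Rightarrow> nat) \<Rightarrow> (nat \<Rightarrow> nat) \<Rightarrow> nat \<Rightarrow> nat" where
  "reflect k \<alpha> \<omega> = (\<lambda>i\<in>{1..k}. if \<alpha> i = 1 then \<omega> i else 1 - \<omega> i)"

lemma reflect_vertices: "\<omega> \<in> vertices k \<Longrightarrow> reflect k \<alpha> \<omega> \<in> vertices k"
  using vertices_coord[of \<omega> k] by (fastforce simp: reflect_def vertices_def)

lemma reflect_reflect:
  assumes "\<omega> \<in> vertices k" shows "reflect k \<alpha> (reflect k \<alpha> \<omega>) = \<omega>"
proof (rule vertices_eqI)
  fix i assume i: "i \<in> {1..k}"
  then show "reflect k \<alpha> (reflect k \<alpha> \<omega>) i = \<omega> i"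
    using vertices_coord[OF assms i] by (auto simp: reflect_def)
qed (use assms in \<open>simp_all add: reflect_vertices\<close>)

lemma reflect_self:
  assumes "\<alpha> \<in> vertices k" shows "reflect k \<alpha> \<alpha> = (\<lambda>i\<in>{1..k}. 1)"
  unfolding reflect_def using vertices_coord[OF assms] by (intro restrict_ext) fastforce

lemma reflect_eq_one_iff:
  assumes "\<alpha> \<in> vertices k" "\<omega> \<in> vertices k"
  shows "reflect k \<alpha> \<omega> = (\<lambda>i\<in>{1..k}. 1) \<longleftrightarrow> \<omega> = \<alpha>"
  using reflect_reflect[OF assms(1), of \<alpha>] reflect_reflect[OF assms(2), of \<alpha>] reflect_self[OF assms(1)]
  by metis

lemma reflect_hyperface:
  assumes "F \<in> hyperfaces k"
  shows "{\<omega> \<in> vertices k. reflect k \<alpha> \<omega> \<in> F} \<in> hyperfaces k"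
proof -
  obtain i a where F: "F = {\<omega> \<in> vertices k. \<omega> i = a}" "i \<in> {1..k}" "a \<in> {0, 1}"
    using assms unfolding hyperfaces_def by blast
  define b where "b = (if \<alpha> i = 1 then a else 1 - a)"
  have "{\<omega> \<in> vertices k. reflect k \<alpha> \<omega> \<in> F} = {\<omega> \<in> vertices k. \<omega> i = b}"
  proof (intro Collect_cong conj_cong refl)
    fix \<omega> assume \<omega>: "\<omega> \<in> vertices k"
    then show "reflect k \<alpha> \<omega> \<in> F \<longleftrightarrow> \<omega> i = b"
      using reflect_vertices[OF \<omega>, of \<alpha>] vertices_coord[OF \<omega> F(2)] F(2,3)
      by (auto simp: F(1) b_def reflect_def)
  qed
  moreover have "b \<in> {0, 1}" using F(3) by (auto simp: b_def)
  ultimately show ?thesis using F(2) unfolding hyperfaces_def by blast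
qed

section \<open>The Host-Kra group\<close>

context group
begin

lemma face_element_carrier:
  "h \<in> carrier G \<Longrightarrow> face_element G k h F \<in> vertices k \<rightarrow>\<^sub>E carrier G"
  by (auto simp: face_element_def)

lemma subgroup_host_kra: "subgroup (host_kra_group G k) (product_group (vertices k) (\<lambda>_. G))"
  unfolding host_kra_group_def
proof (rule group.generate_is_subgroup)
  show "group (product_group (vertices k) (\<lambda>_. G))" using is_group by simp
  show "{face_element G k h F |h F. h \<in> carrier G \<and> F \<in> hyperfaces k}
    \<subseteq> carrier (product_group (vertices k) (\<lambda>_. G))"
    unfolding carrier_product_group using face_element_carrier by blast
qed

lemma host_kra_PiE: "\<gamma> \<in> host_kra_group G k \<Longrightarrow> \<gamma> \<in> vertices k \<rightarrow>\<^sub>E carrier G"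
  using subgroup.subset[OF subgroup_host_kra] by (simp add: subset_iff)

lemma host_kra_carrier: "\<gamma> \<in> host_kra_group G k \<Longrightarrow> \<omega> \<in> vertices k \<Longrightarrow> \<gamma> \<omega> \<in> carrier G"
  using host_kra_PiE by (rule PiE_mem)

lemma host_kra_one: "(\<lambda>\<omega>\<in>vertices k. \<one>) \<in> host_kra_group G k"
  using subgroup.one_closed[OF subgroup_host_kra] by simp

lemma host_kra_mult:
  "\<gamma> \<in> host_kra_group G k \<Longrightarrow> \<delta> \<in> host_kra_group G k \<Longrightarrow>
    (\<lambda>\<omega>\<in>vertices k. \<gamma> \<omega> \<otimes> \<delta> \<omega>) \<in> host_kra_group G k"
  using subgroup.m_closed[OF subgroup_host_kra] by simp

lemma host_kra_face:
  "h \<in> carrier G \<Longrightarrow> F \<in> hyperfaces k \<Longrightarrow> face_element G k h F \<in> host_kra_group G k"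
  unfolding host_kra_group_def by (rule generate.incl) blast

text \<open>A constant element is the product of the elements of two opposite hyperfaces.\<close>

lemma host_kra_const:
  assumes "k \<ge> 1" "g \<in> carrier G"
  shows "(\<lambda>\<omega>\<in>vertices k. g) \<in> host_kra_group G k"
proof -
  let ?F = "\<lambda>a. {\<omega> \<in> vertices k. \<omega> 1 = a}"
  have F: "?F a \<in> hyperfaces k" if "a \<in> {0, 1}" for a
    unfolding hyperfaces_def using that assms(1) by fastforce
  have "(\<lambda>\<omega>\<in>vertices k. face_element G k g (?F 0) \<omega> \<otimes> face_element G k g (?F 1) \<omega>)
      \<in> host_kra_group G k"
    using F assms(2) by (intro host_kra_mult host_kra_face) auto
  also have "(\<lambda>\<omega>\<in>vertices k. face_element G k g (?F 0) \<omega> \<otimes> face_element G k g (?F 1) \<omega>) =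
      (\<lambda>\<omega>\<in>vertices k. g)"
  proof (rule restrict_ext)
    fix \<omega> assume \<omega>: "\<omega> \<in> vertices k"
    show "face_element G k g (?F 0) \<omega> \<otimes> face_element G k g (?F 1) \<omega> = g"
      using vertices_coord[OF \<omega>, of 1] \<omega> assms by (auto simp: face_element_def)
  qed
  finally show ?thesis .
qed

text \<open>Reflections carry hyperfaces to hyperfaces, hence generators to generators, and
  precomposition with them is multiplicative.\<close>

lemma host_kra_reflect:
  assumes "\<gamma> \<in> host_kra_group G k"
  shows "(\<lambda>\<omega>\<in>vertices k. \<gamma> (reflect k \<alpha> \<omega>)) \<in> host_kra_group G k"
  using assms unfolding host_kra_group_def
proof (induction rule: generate.induct)
  case one
  have "(\<lambda>\<omega>\<in>vertices k. \<one>\<^bsub>product_group (vertices k) (\<lambda>_. G)\<^esub> (reflect k \<alpha> \<omega>)) = (\<lambda>\<omega>\<in>vertices k. \<one>)"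
    by (rule restrict_ext) (simp add: reflect_vertices)
  then show ?case using host_kra_one[of k] unfolding host_kra_group_def by (simp only:)
next
  \<comment> \<open>This serves generators and their inverses, since the inverse of a face element
    is the face element of \<open>inv h\<close>.\<close>
  have gen: "(\<lambda>\<omega>\<in>vertices k. face_element G k h F (reflect k \<alpha> \<omega>)) \<in> host_kra_group G k"
    if "h \<in> carrier G" "F \<in> hyperfaces k" for h F
  proof -
    have "(\<lambda>\<omega>\<in>vertices k. face_element G k h F (reflect k \<alpha> \<omega>)) =
        face_element G k h {\<omega> \<in> vertices k. reflect k \<alpha> \<omega> \<in> F}"
      unfolding face_element_def by (intro restrict_ext) (simp add: reflect_vertices)
    then show ?thesis using host_kra_face[OF that(1) reflect_hyperface[OF that(2)]] by metis
  qed
  {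
    case (incl \<gamma>)
    then show ?case using gen unfolding host_kra_group_def by blast
  next
    case (inv \<gamma>)
    then obtain h F where h: "h \<in> carrier G" "F \<in> hyperfaces k" "\<gamma> = face_element G k h F" by blast
    then have eq: "inv\<^bsub>product_group (vertices k) (\<lambda>_. G)\<^esub> \<gamma> = face_element G k (inv h) F"
      using face_element_carrier[OF h(1)] is_group
      by (subst inv_product_group) (auto simp: face_element_def)
    from gen[OF inv_closed[OF h(1)] h(2)] show ?case unfolding eq host_kra_group_def .
  }
next
  case (eng \<gamma> \<delta>)
  have "(\<lambda>\<omega>\<in>vertices k. (\<gamma> \<otimes>\<^bsub>product_group (vertices k) (\<lambda>_. G)\<^esub> \<delta>) (reflect k \<alpha> \<omega>)) =
      (\<lambda>\<omega>\<in>vertices k. (\<lambda>\<omega>\<in>vertices k. \<gamma> (reflect k \<alpha> \<omega>)) \<omega> \<otimes> (\<lambda>\<omega>\<in>vertices k. \<delta> (reflect k \<alpha> \<omega>)) \<omega>)"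
    by (rule restrict_ext) (simp add: reflect_vertices)
  then show ?case using host_kra_mult[unfolded host_kra_group_def, OF eng.IH] by (simp only:)
qed

end

section \<open>Operations that preserve the dynamical cubes\<close>

context tds
begin

lemma continuous_cube_action:
  assumes "\<gamma> \<in> host_kra_group G k"
  shows "continuous_map (cube_space X k) (cube_space X k) (cube_action act k \<gamma>)"
  unfolding cube_action_def
proof (rule continuous_map_into_cube_space)
  fix \<omega> assume "\<omega> \<in> vertices k"
  then have "continuous_map (cube_space X k) X (act (\<gamma> \<omega>) \<circ> (\<lambda>c. c \<omega>))"
    using host_kra_carrier[OF assms]
    by (intro continuous_map_compose[OF continuous_map_cube_coordinate continuous_map_act]) auto
  then show "continuous_map (cube_space X k) X (\<lambda>c. act (\<gamma> \<omega>) (c \<omega>))" by (simp add: o_def)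
qed

lemma cube_action_const_in_cube_space:
  "\<gamma> \<in> host_kra_group G k \<Longrightarrow> x \<in> topspace X \<Longrightarrow>
    cube_action act k \<gamma> (const_config k x) \<in> topspace (cube_space X k)"
  using act_closed host_kra_carrier
  by (simp add: topspace_cube_space cube_action_def const_config_def)

lemma cube_action_const_in_cubes:
  assumes "\<gamma> \<in> host_kra_group G k" "x \<in> topspace X"
  shows "cube_action act k \<gamma> (const_config k x) \<in> dynamical_cubes G X act k"
  unfolding dynamical_cubes_def
  by (rule subsetD[OF closure_of_subset]) (use cube_action_const_in_cube_space assms in blast)+

lemma const_in_cubes:
  assumes "x \<in> topspace X"
  shows "const_config k x \<in> dynamical_cubes G X act k"
proof -
  have "cube_action act k (\<lambda>\<omega>\<in>vertices k. \<one>) (const_config k x) = const_config k x"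
    using assms by (simp add: cube_action_def const_config_def act_one cong: restrict_cong)
  then show ?thesis using cube_action_const_in_cubes[OF host_kra_one assms] by metis
qed

text \<open>Translates of constant configurations are dense in the cubes and the cubes are closed,
  so a continuous map can be tested on these translates.\<close>

lemma cubes_closure_induct:
  assumes "continuous_map (cube_space X k) (cube_space X k) f" "c \<in> dynamical_cubes G X act k"
    and "\<And>\<gamma> x. \<gamma> \<in> host_kra_group G k \<Longrightarrow> x \<in> topspace X \<Longrightarrow>
      f (cube_action act k \<gamma> (const_config k x)) \<in> dynamical_cubes G X act k"
  shows "f c \<in> dynamical_cubes G X act k"
proof -
  let ?B = "{cube_action act k \<gamma> (const_config k x) |\<gamma> x. \<gamma> \<in> host_kra_group G k \<and> x \<in> topspace X}"
  have "f c \<in> cube_space X k closure_of (f ` ?B)"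
    using continuous_map_image_closure_subset[OF assms(1), of ?B] assms(2)
    unfolding dynamical_cubes_def by (rule subsetD[OF _ imageI])
  moreover have "f ` ?B \<subseteq> dynamical_cubes G X act k" using assms(3) by auto
  ultimately show ?thesis
    using closure_of_minimal[OF _ closedin_dynamical_cubes] by (meson subsetD)
qed

lemma cubes_invariant:
  assumes \<gamma>: "\<gamma> \<in> host_kra_group G k" and c: "c \<in> dynamical_cubes G X act k"
  shows "cube_action act k \<gamma> c \<in> dynamical_cubes G X act k"
proof (rule cubes_closure_induct[OF continuous_cube_action[OF \<gamma>] c])
  fix \<delta> x assume \<delta>: "\<delta> \<in> host_kra_group G k" and x: "x \<in> topspace X"
  have "cube_action act k \<gamma> (cube_action act k \<delta> (const_config k x)) =
      cube_action act k (\<lambda>\<omega>\<in>vertices k. \<gamma> \<omega> \<otimes> \<delta> \<omega>) (const_config k x)"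
    unfolding cube_action_def const_config_def
    using host_kra_carrier[OF \<gamma>] host_kra_carrier[OF \<delta>] x
    by (intro restrict_ext) (simp add: composition_rule)
  then show "cube_action act k \<gamma> (cube_action act k \<delta> (const_config k x)) \<in> dynamical_cubes G X act k"
    using cube_action_const_in_cubes[OF host_kra_mult[OF \<gamma> \<delta>] x] by metis
qed

text \<open>A constant configuration does not see the reflection, which therefore only acts on the
  group element.\<close>

lemma cubes_reflect:
  assumes c: "c \<in> dynamical_cubes G X act k"
  shows "(\<lambda>\<omega>\<in>vertices k. c (reflect k \<alpha> \<omega>)) \<in> dynamical_cubes G X act k"
proof (rule cubes_closure_induct[OF _ c])
  show "continuous_map (cube_space X k) (cube_space X k) (\<lambda>c. \<lambda>\<omega>\<in>vertices k. c (reflect k \<alpha> \<omega>))"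
    by (intro continuous_map_into_cube_space continuous_map_cube_coordinate reflect_vertices)
  fix \<gamma> x assume \<gamma>: "\<gamma> \<in> host_kra_group G k" and x: "x \<in> topspace X"
  have "(\<lambda>\<omega>\<in>vertices k. cube_action act k \<gamma> (const_config k x) (reflect k \<alpha> \<omega>)) =
      cube_action act k (\<lambda>\<omega>\<in>vertices k. \<gamma> (reflect k \<alpha> \<omega>)) (const_config k x)"
    unfolding cube_action_def const_config_def
    by (intro restrict_ext) (simp add: reflect_vertices)
  then show "(\<lambda>\<omega>\<in>vertices k. cube_action act k \<gamma> (const_config k x) (reflect k \<alpha> \<omega>))
      \<in> dynamical_cubes G X act k"
    using cube_action_const_in_cubes[OF host_kra_reflect[OF \<gamma>] x] by metis
qed

text \<open>Dividing \<open>\<gamma>\<close> by its value at \<open>\<alpha>\<close> turns \<open>\<gamma> x\<close> into \<open>\<delta> y\<close> with \<open>y = \<gamma>(\<alpha>) x\<close> and \<open>\<delta>(\<alpha>) = 1\<close>.\<close>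

lemma cubes_approx:
  assumes "k \<ge> 1" and c: "c \<in> dynamical_cubes G X act k" and \<alpha>: "\<alpha> \<in> vertices k"
    and U: "openin (cube_space X k) U" "c \<in> U"
  obtains \<gamma> x where "\<gamma> \<in> host_kra_group G k" "\<gamma> \<alpha> = \<one>" "x \<in> topspace X"
    "cube_action act k \<gamma> (const_config k x) \<in> U"
proof -
  obtain \<gamma> x where \<gamma>: "\<gamma> \<in> host_kra_group G k" and x: "x \<in> topspace X"
    and \<gamma>U: "cube_action act k \<gamma> (const_config k x) \<in> U"
    using c U unfolding dynamical_cubes_def in_closure_of by blast
  have h: "\<gamma> \<alpha> \<in> carrier G" using host_kra_carrier[OF \<gamma> \<alpha>] .
  let ?\<delta> = "\<lambda>\<omega>\<in>vertices k. \<gamma> \<omega> \<otimes> (\<lambda>\<omega>\<in>vertices k. inv (\<gamma> \<alpha>)) \<omega>"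
  have \<delta>: "?\<delta> \<in> host_kra_group G k"
    using h by (intro host_kra_mult \<gamma> host_kra_const \<open>k \<ge> 1\<close>) auto
  have "cube_action act k ?\<delta> (const_config k (act (\<gamma> \<alpha>) x)) = cube_action act k \<gamma> (const_config k x)"
    unfolding cube_action_def const_config_def
  proof (rule restrict_ext)
    fix \<omega> assume \<omega>: "\<omega> \<in> vertices k"
    have "act (\<gamma> \<omega> \<otimes> inv (\<gamma> \<alpha>)) (act (\<gamma> \<alpha>) x) = act (\<gamma> \<omega> \<otimes> inv (\<gamma> \<alpha>) \<otimes> \<gamma> \<alpha>) x"
      using host_kra_carrier[OF \<gamma> \<omega>] h x by (simp add: composition_rule)
    also have "\<gamma> \<omega> \<otimes> inv (\<gamma> \<alpha>) \<otimes> \<gamma> \<alpha> = \<gamma> \<omega>"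
      using host_kra_carrier[OF \<gamma> \<omega>] h by (simp add: m_assoc)
    finally show "act (?\<delta> \<omega>) ((\<lambda>\<omega>\<in>vertices k. act (\<gamma> \<alpha>) x) \<omega>) = act (\<gamma> \<omega>) ((\<lambda>\<omega>\<in>vertices k. x) \<omega>)"
      using \<omega> by simp
  qed
  then show thesis
    using that[OF \<delta>, of "act (\<gamma> \<alpha>) x"] \<gamma>U \<alpha> h x act_closed by simp
qed

lemma continuous_map_apply_on_vertices:
  assumes "c \<in> dynamical_cubes G X act k"
  shows "continuous_map (pointwise_topology X) (cube_space X k)
    (\<lambda>p. \<lambda>\<omega>\<in>vertices k. if \<omega> \<in> F then p (c \<omega>) else c \<omega>)"
proof (rule continuous_map_into_cube_space)
  fix \<omega> assume "\<omega> \<in> vertices k"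
  then have "c \<omega> \<in> topspace X" using cube_coordinate[OF assms] by blast
  then show "continuous_map (pointwise_topology X) X (\<lambda>p. if \<omega> \<in> F then p (c \<omega>) else c \<omega>)"
    by (intro continuous_map_if continuous_map_eval_pointwise) auto
qed

text \<open>For a translation this is the action of a face element. A general \<open>p\<close> is a
  limit of translations, and for fixed \<open>c\<close> the new configuration depends continuously
  on \<open>p\<close>.\<close>

lemma cubes_apply_face:
  assumes c: "c \<in> dynamical_cubes G X act k" and p: "p \<in> enveloping" and F: "F \<in> hyperfaces k"
  shows "(\<lambda>\<omega>\<in>vertices k. if \<omega> \<in> F then p (c \<omega>) else c \<omega>) \<in> dynamical_cubes G X act k"
proof -
  let ?f = "\<lambda>p. \<lambda>\<omega>\<in>vertices k. if \<omega> \<in> F then p (c \<omega>) else c \<omega>"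
  have "?f p \<in> cube_space X k closure_of (?f ` act ` carrier G)"
    using continuous_map_image_closure_subset[OF continuous_map_apply_on_vertices[OF c]] p
    unfolding enveloping_def by (rule subsetD[OF _ imageI])
  moreover have "?f (act g) \<in> dynamical_cubes G X act k" if g: "g \<in> carrier G" for g
  proof -
    have "?f (act g) = cube_action act k (face_element G k g F) c"
      unfolding cube_action_def face_element_def
      by (rule restrict_ext) (simp add: act_one cube_coordinate[OF c])
    then show ?thesis using cubes_invariant[OF host_kra_face[OF g F] c] by metis
  qed
  then have "?f ` act ` carrier G \<subseteq> dynamical_cubes G X act k" by blast
  ultimately show ?thesis
    using closure_of_minimal[OF _ closedin_dynamical_cubes] by (meson subsetD)
qed

text \<open>Two opposite hyperfaces partition the vertices, so applying \<open>p\<close> on each of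
  them applies it exactly once everywhere.\<close>

lemma cubes_apply:
  assumes "k \<ge> 1" and c: "c \<in> dynamical_cubes G X act k" and p: "p \<in> enveloping"
  shows "(\<lambda>\<omega>\<in>vertices k. p (c \<omega>)) \<in> dynamical_cubes G X act k"
proof -
  let ?F = "\<lambda>a. {\<omega> \<in> vertices k. \<omega> 1 = a}"
  have F: "?F a \<in> hyperfaces k" if "a \<in> {0, 1}" for a
    unfolding hyperfaces_def using that assms(1) by fastforce
  let ?c = "\<lambda>\<omega>\<in>vertices k. if \<omega> \<in> ?F 0 then p (c \<omega>) else c \<omega>"
  have "?c \<in> dynamical_cubes G X act k" using F by (intro cubes_apply_face c p) auto
  from cubes_apply_face[OF this p F[of 1]]
  have "(\<lambda>\<omega>\<in>vertices k. if \<omega> \<in> ?F 1 then p (?c \<omega>) else ?c \<omega>) \<in> dynamical_cubes G X act k"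
    by simp
  also have "(\<lambda>\<omega>\<in>vertices k. if \<omega> \<in> ?F 1 then p (?c \<omega>) else ?c \<omega>) = (\<lambda>\<omega>\<in>vertices k. p (c \<omega>))"
  proof (rule restrict_ext)
    fix \<omega> assume \<omega>: "\<omega> \<in> vertices k"
    then show "(if \<omega> \<in> ?F 1 then p (?c \<omega>) else ?c \<omega>) = p (c \<omega>)"
      using vertices_coord[OF \<omega>, of 1] assms(1) by auto
  qed
  finally show ?thesis .
qed

text \<open>Apply the idempotent on all hyperfaces that miss \<open>\<alpha>\<close>, one after the other.\<close>

lemma cubes_apply_off_vertex:
  assumes c: "c \<in> dynamical_cubes G X act k" and u: "u \<in> enveloping"
    and idem: "\<And>x. x \<in> topspace X \<Longrightarrow> u (u x) = u x" and \<alpha>: "\<alpha> \<in> vertices k"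
  shows "(\<lambda>\<omega>\<in>vertices k. if \<omega> = \<alpha> then c \<omega> else u (c \<omega>)) \<in> dynamical_cubes G X act k"
proof -
  \<comment> \<open>After \<open>n\<close> steps the changed vertices are those that differ from
    \<alpha> in one of the first \<open>n\<close> coordinates. A vertex may lie on several of the
    hyperfaces, and idempotence makes repeated application harmless.\<close>
  let ?c = "\<lambda>n. \<lambda>\<omega>\<in>vertices k. if \<exists>i\<in>{1..n}. \<omega> i \<noteq> \<alpha> i then u (c \<omega>) else c \<omega>"
  have "n \<le> k \<Longrightarrow> ?c n \<in> dynamical_cubes G X act k" for n
  proof (induction n)
    case 0
    then show ?case using c by (simp add: cube_restrict)
  next
    case (Suc n)
    let ?F = "{\<omega> \<in> vertices k. \<omega> (Suc n) = 1 - \<alpha> (Suc n)}"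
    have "1 - \<alpha> (Suc n) \<in> {0, 1}" using vertices_coord[OF \<alpha>, of "Suc n"] Suc.prems by auto
    then have F: "?F \<in> hyperfaces k" unfolding hyperfaces_def using Suc.prems by fastforce
    have "(\<lambda>\<omega>\<in>vertices k. if \<omega> \<in> ?F then u (?c n \<omega>) else ?c n \<omega>) \<in> dynamical_cubes G X act k"
      using Suc by (intro cubes_apply_face u F) auto
    also have "(\<lambda>\<omega>\<in>vertices k. if \<omega> \<in> ?F then u (?c n \<omega>) else ?c n \<omega>) = ?c (Suc n)"
    proof (rule restrict_ext)
      fix \<omega> assume \<omega>: "\<omega> \<in> vertices k"
      have "\<omega> \<in> ?F \<longleftrightarrow> \<omega> (Suc n) \<noteq> \<alpha> (Suc n)"
        using vertices_coord[OF \<alpha>, of "Suc n"] vertices_coord[OF \<omega>, of "Suc n"] Suc.prems \<omega> by auto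
      moreover have "{1..Suc n} = insert (Suc n) {1..n}" by auto
      ultimately show "(if \<omega> \<in> ?F then u (?c n \<omega>) else ?c n \<omega>) =
          (if \<exists>i\<in>{1..Suc n}. \<omega> i \<noteq> \<alpha> i then u (c \<omega>) else c \<omega>)"
        using \<omega> idem[OF cube_coordinate[OF c \<omega>]] by simp
    qed
    finally show ?case .
  qed
  from this[of k] have "?c k \<in> dynamical_cubes G X act k" by simp
  also have "?c k = (\<lambda>\<omega>\<in>vertices k. if \<omega> = \<alpha> then c \<omega> else u (c \<omega>))"
  proof (rule restrict_ext)
    fix \<omega> assume "\<omega> \<in> vertices k"
    then have "(\<exists>i\<in>{1..k}. \<omega> i \<noteq> \<alpha> i) \<longleftrightarrow> \<omega> \<noteq> \<alpha>" using vertices_eqI \<alpha> by blast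
    then show "(if \<exists>i\<in>{1..k}. \<omega> i \<noteq> \<alpha> i then u (c \<omega>) else c \<omega>) = (if \<omega> = \<alpha> then c \<omega> else u (c \<omega>))"
      by simp
  qed
  finally show ?thesis .
qed

end

section \<open>Saturation of the cubes\<close>

context tds
begin

text \<open>The first argument is the exceptional value. All vertices are allowed because later
  arguments replace the values of a cube at one vertex after another.\<close>

definition cube_related :: "nat \<Rightarrow> 'x \<Rightarrow> 'x \<Rightarrow> bool" where
  "cube_related k y x \<longleftrightarrow> x \<in> topspace X \<and> y \<in> topspace X \<and>
     (\<forall>\<alpha>\<in>vertices k. (\<lambda>\<omega>\<in>vertices k. if \<omega> = \<alpha> then y else x) \<in> dynamical_cubes G X act k)"

lemma cube_related_topspace:
  "cube_related k y x \<Longrightarrow> x \<in> topspace X" "cube_related k y x \<Longrightarrow> y \<in> topspace X"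
  by (simp_all add: cube_related_def)

lemma cube_relatedD:
  "cube_related k y x \<Longrightarrow> \<alpha> \<in> vertices k \<Longrightarrow>
    (\<lambda>\<omega>\<in>vertices k. if \<omega> = \<alpha> then y else x) \<in> dynamical_cubes G X act k"
  by (simp add: cube_related_def)

lemma one_vertex: "(\<lambda>i\<in>{1..k}. 1) \<in> vertices k"
  by (simp add: vertices_def)

text \<open>Reflections move the corner at the all-ones vertex to any other vertex. The arguments
  are swapped, and order \<open>d\<close> corresponds to dimension \<open>d + 1\<close>.\<close>

lemma NRP_iff_cube_related: "(x, y) \<in> NRP G X act d \<longleftrightarrow> cube_related (d + 1) y x"
proof
  assume "(x, y) \<in> NRP G X act d"
  then have xy: "x \<in> topspace X" "y \<in> topspace X"
    and c: "corner_config (d + 1) x y \<in> dynamical_cubes G X act (d + 1)"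
    by (auto simp: NRP_def)
  have "(\<lambda>\<omega>\<in>vertices (d + 1). if \<omega> = \<alpha> then y else x) \<in> dynamical_cubes G X act (d + 1)"
    if \<alpha>: "\<alpha> \<in> vertices (d + 1)" for \<alpha>
  proof -
    have "(\<lambda>\<omega>\<in>vertices (d + 1). corner_config (d + 1) x y (reflect (d + 1) \<alpha> \<omega>)) =
        (\<lambda>\<omega>\<in>vertices (d + 1). if \<omega> = \<alpha> then y else x)"
      by (rule restrict_ext)
        (simp only: corner_config_def restrict_apply' reflect_vertices reflect_eq_one_iff[OF \<alpha>])
    then show ?thesis using cubes_reflect[OF c, of \<alpha>] by (simp only:)
  qed
  then show "cube_related (d + 1) y x" using xy by (simp add: cube_related_def)
next
  assume R: "cube_related (d + 1) y x"
  have "corner_config (d + 1) x y \<in> dynamical_cubes G X act (d + 1)"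
    unfolding corner_config_def by (rule cube_relatedD[OF R one_vertex])
  then show "(x, y) \<in> NRP G X act d"
    using cube_related_topspace[OF R] by (simp add: NRP_def)
qed

lemma cube_related_refl: "x \<in> topspace X \<Longrightarrow> cube_related k x x"
  using const_in_cubes[of x k] by (simp add: cube_related_def const_config_def)

lemma cube_related_apply:
  assumes "k \<ge> 1" "p \<in> enveloping" "cube_related k y x" "p x \<in> topspace X" "p y \<in> topspace X"
  shows "cube_related k (p y) (p x)"
proof -
  have "(\<lambda>\<omega>\<in>vertices k. if \<omega> = \<alpha> then p y else p x) \<in> dynamical_cubes G X act k"
    if "\<alpha> \<in> vertices k" for \<alpha>
  proof -
    have "(\<lambda>\<omega>\<in>vertices k. p ((\<lambda>\<omega>\<in>vertices k. if \<omega> = \<alpha> then y else x) \<omega>)) =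
        (\<lambda>\<omega>\<in>vertices k. if \<omega> = \<alpha> then p y else p x)"
      by (rule restrict_ext) simp
    then show ?thesis
      using cubes_apply[OF assms(1) cube_relatedD[OF assms(3) that] assms(2)] by (simp only:)
  qed
  then show ?thesis using assms by (simp add: cube_related_def)
qed

lemma cube_related_act:
  "k \<ge> 1 \<Longrightarrow> g \<in> carrier G \<Longrightarrow> cube_related k y x \<Longrightarrow> cube_related k (act g y) (act g x)"
  by (rule cube_related_apply[OF _ act_in_enveloping]) (simp_all add: act_closed cube_related_def)

end

section \<open>Replacing values of a cube by related ones\<close>

context minimal_tds
begin

text \<open>\<open>J x\<close> collects the finitely many boxes \<open>U\<close> that the orbit of \<open>x\<^bsup>[k]\<^esup>\<close> under the elements of the
  Host-Kra group that are trivial at \<open>\<alpha>\<close> meets off \<open>\<alpha>\<close>. It is locally nondecreasing in \<open>x\<close>, hence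
  constant near a point where its size is maximal. There every cube with value \<open>x\<close> at \<open>\<alpha>\<close> is
  approximated, up to these boxes, by the orbit of \<open>x\<^bsup>[k]\<^esup>\<close> itself, and the same group elements applied to
  the corner \<open>(y, x, \<dots>, x)\<close> approximate the cube with \<open>y\<close> in place of \<open>x\<close>.\<close>

lemma cubes_replace_vertex:
  assumes k: "k \<ge> 1" and c: "c \<in> dynamical_cubes G X act k" and \<alpha>: "\<alpha> \<in> vertices k"
    and y: "cube_related k y (c \<alpha>)" and w: "w \<in> M"
  shows "(\<lambda>\<omega>\<in>vertices k. w (if \<omega> = \<alpha> then y else c \<omega>)) \<in> dynamical_cubes G X act k"
proof (rule ccontr)
  let ?I = "vertices k" and ?C = "dynamical_cubes G X act k" and ?HK = "host_kra_group G k"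
  define e where "e q = (\<lambda>\<omega>\<in>?I. q (if \<omega> = \<alpha> then y else c \<omega>))" for q :: "'x \<Rightarrow> 'x"
  assume "(\<lambda>\<omega>\<in>?I. w (if \<omega> = \<alpha> then y else c \<omega>)) \<notin> ?C"
  then have nw: "e w \<notin> ?C" by (simp add: e_def)
  have yX: "y \<in> topspace X" using cube_related_topspace(2)[OF y] .
  have cX: "(if \<omega> = \<alpha> then y else c \<omega>) \<in> topspace X" if "\<omega> \<in> ?I" for \<omega>
    using cube_coordinate[OF c that] yX by simp
  have cont: "continuous_map (pointwise_topology X) (cube_space X k) e"
    unfolding e_def by (intro continuous_map_into_cube_space continuous_map_eval_pointwise cX)
  \<comment> \<open>The maps in \<open>M\<close> that send the modified configuration to a cube form
    a closed set, invariant because constant group elements preserve cubes. By minimality of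
    \<open>M\<close> it is empty or all of \<open>M\<close>, so one failure at \<open>w\<close>
    means failure at every \<open>q\<close> in \<open>M\<close>.\<close>
  define D where "D = {q \<in> M. e q \<in> ?C}"
  have "D = M" if "D \<noteq> {}"
  proof (rule ideal_minimal[OF _ that])
    show "closedin (pointwise_topology X) D"
      unfolding D_def by (rule closedin_continuous_map_preimage_gen[OF cont ideal_closed closedin_dynamical_cubes])
    fix g q assume g: "g \<in> carrier G" and q: "q \<in> D"
    have "e (compose (topspace X) (act g) q) = cube_action act k (\<lambda>\<omega>\<in>?I. g) (e q)"
      unfolding e_def cube_action_def by (rule restrict_ext) (simp add: compose_eq[OF cX])
    then show "compose (topspace X) (act g) q \<in> D"
      using cubes_invariant[OF host_kra_const[OF k g]] ideal_invariant[OF g] q by (simp add: D_def)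
  qed (auto simp: D_def)
  then have notC: "e q \<notin> ?C" if "q \<in> M" for q using that w nw by (auto simp: D_def)
  define \<G> where "\<G> = {U. (\<forall>\<omega>\<in>?I. openin X (U \<omega>)) \<and> Pi\<^sub>E ?I U \<inter> ?C = {}}"
  have "compactin (cube_space X k) (e ` M)" by (rule image_compactin[OF compactin_ideal cont])
  moreover have "openin (cube_space X k) B" if "B \<in> Pi\<^sub>E ?I ` \<G>" for B
    using that finite_vertices unfolding cube_space_def \<G>_def by (auto simp: openin_PiE)
  moreover have "e ` M \<subseteq> \<Union>(Pi\<^sub>E ?I ` \<G>)"
  proof
    fix b assume "b \<in> e ` M"
    then have b: "b \<in> topspace (cube_space X k) - ?C"
      using notC closedin_subset[OF ideal_closed] continuous_map_image_subset_topspace[OF cont] by blast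
    have "openin (cube_space X k) (topspace (cube_space X k) - ?C)"
      using closedin_dynamical_cubes by blast
    then obtain U where "\<forall>\<omega>\<in>?I. openin X (U \<omega>)" "b \<in> Pi\<^sub>E ?I U"
      "Pi\<^sub>E ?I U \<subseteq> topspace (cube_space X k) - ?C"
      using b unfolding cube_space_def openin_product_topology_alt by blast
    then show "b \<in> \<Union>(Pi\<^sub>E ?I ` \<G>)" unfolding \<G>_def by blast
  qed
  ultimately obtain \<F> where "finite \<F>" "\<F> \<subseteq> Pi\<^sub>E ?I ` \<G>" "e ` M \<subseteq> \<Union>\<F>"
    using compactinD by metis
  then obtain \<U> where \<U>: "finite \<U>" "\<U> \<subseteq> \<G>" "e ` M \<subseteq> \<Union>(Pi\<^sub>E ?I ` \<U>)"
    using finite_subset_image by metis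
  define meets where "meets \<gamma> x U \<longleftrightarrow> (\<forall>\<omega>\<in>?I - {\<alpha>}. act (\<gamma> \<omega>) x \<in> U \<omega>)" for \<gamma> x U
  define J where "J x = {U \<in> \<U>. \<exists>\<gamma>\<in>?HK. \<gamma> \<alpha> = \<one> \<and> meets \<gamma> x U}" for x
  have finJ: "finite (J x)" for x using \<U>(1) by (simp add: J_def)
  \<comment> \<open>The sizes are bounded, so a largest one exists; the point \<open>y\<close>
    serves as evidence that the space is nonempty.\<close>
  have "card (J x) < Suc (card \<U>)" for x
    using \<U>(1) unfolding less_Suc_eq_le by (intro card_mono) (auto simp: J_def)
  then obtain x0 where x0: "x0 \<in> topspace X"
    and max: "\<And>x. x \<in> topspace X \<Longrightarrow> card (J x) \<le> card (J x0)"
    using Lattices_Big.ex_has_greatest_nat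
      [of "\<lambda>x. x \<in> topspace X" y "\<lambda>x. card (J x)" "Suc (card \<U>)", OF yX] by metis
  have "\<forall>U\<in>J x0. \<exists>\<gamma>\<in>?HK. \<gamma> \<alpha> = \<one> \<and> meets \<gamma> x0 U" by (simp add: J_def)
  then obtain \<Gamma> where \<Gamma>: "\<And>U. U \<in> J x0 \<Longrightarrow> \<Gamma> U \<in> ?HK \<and> \<Gamma> U \<alpha> = \<one> \<and> meets (\<Gamma> U) x0 U"
    by metis
  \<comment> \<open>A neighbourhood of \<open>x0\<close>: each witness \<open>\<Gamma> U\<close>
    still works at nearby points, since only finitely many open conditions are involved.\<close>
  define N where "N = {x \<in> topspace X. \<forall>U\<in>J x0. \<forall>\<omega>\<in>?I - {\<alpha>}. act (\<Gamma> U \<omega>) x \<in> U \<omega>}"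
  have "openin X {x \<in> topspace X. \<forall>\<omega>\<in>?I - {\<alpha>}. act (\<Gamma> U \<omega>) x \<in> U \<omega>}" if U: "U \<in> J x0" for U
  proof (rule openin_Collect_Ball)
    fix \<omega> assume \<omega>: "\<omega> \<in> ?I - {\<alpha>}"
    have "U \<in> \<G>" using U \<U>(2) by (auto simp: J_def)
    then have "openin X (U \<omega>)" using \<omega> by (simp add: \<G>_def)
    then show "openin X {x \<in> topspace X. act (\<Gamma> U \<omega>) x \<in> U \<omega>}"
      using \<Gamma>[OF U] \<omega>
      by (intro openin_continuous_map_preimage[OF continuous_map_act] host_kra_carrier[of "\<Gamma> U" k]) simp_all
  qed (simp add: finite_vertices)
  then have openN: "openin X N" unfolding N_def by (rule openin_Collect_Ball[OF finJ])
  have x0N: "x0 \<in> N" using x0 \<Gamma> by (auto simp: N_def meets_def)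
  have JN: "J x = J x0" if "x \<in> N" for x
  proof -
    have "J x0 \<subseteq> J x"
    proof
      fix U assume U: "U \<in> J x0"
      then have "meets (\<Gamma> U) x U" using that by (auto simp: N_def meets_def)
      then show "U \<in> J x" using \<Gamma>[OF U] U by (auto simp: J_def)
    qed
    then show ?thesis using card_seteq[OF finJ] max that by (auto simp: N_def)
  qed
  \<comment> \<open>Moving everything by this \<open>q\<close> brings the value at \<alpha> to the
    point where \<open>J\<close> is locally constant. One of the finitely many boxes contains
    \<open>e q\<close>.\<close>
  obtain q where q: "q \<in> M" "q (c \<alpha>) = x0"
    using ideal_eval_onto[OF cube_coordinate[OF c \<alpha>] x0] .
  have qE: "q \<in> enveloping" using q(1) ideal_sub by blast
  obtain U where U: "U \<in> \<U>" "e q \<in> Pi\<^sub>E ?I U" using \<U>(3) q(1) by blast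
  have eU: "q (if \<omega> = \<alpha> then y else c \<omega>) \<in> U \<omega>" if "\<omega> \<in> ?I" for \<omega>
    using PiE_mem[OF U(2) that] that by (simp add: e_def)
  have Uopen: "openin X (U \<omega>)" if "\<omega> \<in> ?I" for \<omega> using U(1) \<U>(2) that by (auto simp: \<G>_def)
  \<comment> \<open>A neighbourhood of the cube \<open>q c\<close>. It agrees with
    \<open>e q\<close> off \<alpha>, so \<open>U\<close> is kept there; at \<alpha> its value is
    \<open>x0\<close> instead of \<open>q y\<close>, so \<open>N\<close> takes the place of
    \<open>U \<alpha>\<close>.\<close>
  define V where "V = Pi\<^sub>E ?I (\<lambda>\<omega>. if \<omega> = \<alpha> then N else U \<omega>)"
  have "openin (cube_space X k) V"
    unfolding V_def cube_space_def using finite_vertices openN Uopen by (simp add: openin_PiE)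
  moreover have "(\<lambda>\<omega>\<in>?I. q (c \<omega>)) \<in> V"
    using eU q(2) x0N unfolding V_def by (auto split: if_splits) metis
  ultimately obtain \<gamma> x where \<gamma>: "\<gamma> \<in> ?HK" "\<gamma> \<alpha> = \<one>" "x \<in> topspace X"
    "cube_action act k \<gamma> (const_config k x) \<in> V"
    using cubes_approx[OF k cubes_apply[OF k c qE] \<alpha>] by metis
  have \<gamma>x: "act (\<gamma> \<omega>) x \<in> (if \<omega> = \<alpha> then N else U \<omega>)" if "\<omega> \<in> ?I" for \<omega>
    using PiE_mem[OF \<gamma>(4)[unfolded V_def] that] that by (simp add: cube_action_def const_config_def)
  have "x \<in> N" using \<gamma>x[OF \<alpha>] \<gamma>(2,3) by (simp add: act_one)
  moreover have "meets \<gamma> x U"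
    unfolding meets_def
  proof
    fix \<omega> assume "\<omega> \<in> ?I - {\<alpha>}"
    then show "act (\<gamma> \<omega>) x \<in> U \<omega>" using \<gamma>x[of \<omega>] by simp
  qed
  then have "U \<in> J x" using \<gamma> U(1) by (auto simp: J_def)
  ultimately have "U \<in> J x0" using JN by simp
  then obtain \<delta> where \<delta>: "\<delta> \<in> ?HK" "\<delta> \<alpha> = \<one>" "meets \<delta> x0 U" using \<Gamma> by blast
  \<comment> \<open>This cube lies in the box \<open>U\<close>: off \<alpha> by the choice of
    \<delta>, and at \<alpha> because \<delta> is trivial there and \<open>e q\<close> has the value
    \<open>q y\<close>. But \<open>U\<close> contains no cube.\<close>
  let ?b = "cube_action act k \<delta> (\<lambda>\<omega>\<in>?I. if \<omega> = \<alpha> then q y else x0)"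
  have "cube_related k (q y) x0"
    using cube_related_apply[OF k qE y] q ideal_maps yX x0 by simp
  then have "?b \<in> ?C" by (intro cubes_invariant \<delta> cube_relatedD \<alpha>)
  moreover have "?b \<in> Pi\<^sub>E ?I U"
    unfolding cube_action_def restrict_PiE_iff
  proof
    fix \<omega> assume \<omega>: "\<omega> \<in> ?I"
    show "act (\<delta> \<omega>) ((\<lambda>\<omega>\<in>?I. if \<omega> = \<alpha> then q y else x0) \<omega>) \<in> U \<omega>"
    proof (cases "\<omega> = \<alpha>")
      case True
      then show ?thesis using eU[OF \<omega>] \<delta>(2) \<omega> ideal_maps[OF q(1) yX] by (simp add: act_one)
    next
      case False
      then show ?thesis using \<delta>(3) \<omega> by (simp add: meets_def)
    qed
  qed
  moreover have "Pi\<^sub>E ?I U \<inter> ?C = {}" using U(1) \<U>(2) by (auto simp: \<G>_def)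
  ultimately show False by blast
qed

lemma idempotents_sub: "u \<in> idempotents \<Longrightarrow> u \<in> M" "u \<in> idempotents \<Longrightarrow> u \<in> enveloping"
  using ideal_sub by (auto simp: idempotents_def)

lemma idempotent_maps: "u \<in> idempotents \<Longrightarrow> x \<in> topspace X \<Longrightarrow> u x \<in> topspace X"
  using ideal_maps idempotents_sub by blast

lemma cube_related_ideal:
  "k \<ge> 1 \<Longrightarrow> p \<in> M \<Longrightarrow> cube_related k y x \<Longrightarrow> cube_related k (p y) (p x)"
  using cube_related_apply[of k p y x] ideal_sub ideal_maps cube_related_topspace[of k y x] by auto

text \<open>Induction over the set of vertices already changed. Every replacement brings a further
  \<open>w\<close>, which idempotence absorbs; the relation needed at the new vertex is the image
  under \<open>w\<close> of the given one.\<close>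

lemma cubes_saturated:
  assumes k: "k \<ge> 1" and c: "c \<in> dynamical_cubes G X act k"
    and c': "\<And>\<omega>. \<omega> \<in> vertices k \<Longrightarrow> cube_related k (c' \<omega>) (c \<omega>)" and w: "w \<in> idempotents"
  shows "(\<lambda>\<omega>\<in>vertices k. w (c' \<omega>)) \<in> dynamical_cubes G X act k"
proof -
  have X: "c \<omega> \<in> topspace X" "c' \<omega> \<in> topspace X" if "\<omega> \<in> vertices k" for \<omega>
    using cube_related_topspace[OF c'[OF that]] by auto
  have "(\<lambda>\<omega>\<in>vertices k. w (if \<omega> \<in> A then c' \<omega> else c \<omega>)) \<in> dynamical_cubes G X act k"
    if "finite A" "A \<subseteq> vertices k" for A
    using that
  proof (induction A)
    case empty
    then show ?case using cubes_apply[OF k c idempotents_sub(2)[OF w]] by (simp only: empty_iff if_False)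
  next
    case (insert \<alpha> A)
    let ?b = "\<lambda>\<omega>\<in>vertices k. w (if \<omega> \<in> A then c' \<omega> else c \<omega>)"
    have \<alpha>: "\<alpha> \<in> vertices k" using insert.prems by simp
    have b: "?b \<in> dynamical_cubes G X act k" by (rule insert.IH) (use insert.prems in simp)
    have "?b \<alpha> = w (c \<alpha>)" using insert by simp
    then have "cube_related k (w (c' \<alpha>)) (?b \<alpha>)"
      using cube_related_ideal[OF k idempotents_sub(1)[OF w] c'[OF \<alpha>]] by simp
    then have "(\<lambda>\<omega>\<in>vertices k. w (if \<omega> = \<alpha> then w (c' \<alpha>) else ?b \<omega>)) \<in> dynamical_cubes G X act k"
      by (rule cubes_replace_vertex[OF k b \<alpha> _ idempotents_sub(1)[OF w]])
    also have "(\<lambda>\<omega>\<in>vertices k. w (if \<omega> = \<alpha> then w (c' \<alpha>) else ?b \<omega>)) =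
        (\<lambda>\<omega>\<in>vertices k. w (if \<omega> \<in> insert \<alpha> A then c' \<omega> else c \<omega>))"
      using X idempotent_twice[OF w] by (intro restrict_ext) auto
    finally show ?case .
  qed
  from this[OF finite_vertices order_refl] show ?thesis by (simp cong: restrict_cong)
qed

section \<open>Removing idempotents, and the equivalence relation\<close>

lemma cube_related_apply_right:
  assumes R: "cube_related k y x" and u: "u \<in> idempotents"
  shows "cube_related k y (u x)"
proof -
  have "(\<lambda>\<omega>\<in>vertices k. if \<omega> = \<alpha> then y else u x) \<in> dynamical_cubes G X act k"
    if \<alpha>: "\<alpha> \<in> vertices k" for \<alpha>
  proof -
    let ?c = "\<lambda>\<omega>\<in>vertices k. if \<omega> = \<alpha> then y else x"
    \<comment> \<open>Applying the idempotent off \<alpha> changes exactly the constant part of the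
      corner.\<close>
    have "(\<lambda>\<omega>\<in>vertices k. if \<omega> = \<alpha> then ?c \<omega> else u (?c \<omega>)) \<in> dynamical_cubes G X act k"
      by (intro cubes_apply_off_vertex cube_relatedD R idempotents_sub u idempotent_twice \<alpha>)
    also have "(\<lambda>\<omega>\<in>vertices k. if \<omega> = \<alpha> then ?c \<omega> else u (?c \<omega>)) =
        (\<lambda>\<omega>\<in>vertices k. if \<omega> = \<alpha> then y else u x)"
      by (rule restrict_ext) (simp add: \<alpha>)
    finally show ?thesis .
  qed
  then show ?thesis
    using cube_related_topspace[OF R] idempotent_maps[OF u] by (simp add: cube_related_def)
qed

text \<open>An idempotent \<open>u\<close> of \<open>M\<close> that fixes \<open>x\<close> reverses
  \<open>w\<close> at this point: \<open>u (w x) = u x = x\<close>.\<close>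

lemma cube_related_unapply_right:
  assumes R: "cube_related k y (w x)" and w: "w \<in> idempotents" and x: "x \<in> topspace X"
  shows "cube_related k y x"
proof -
  obtain u where u: "u \<in> idempotents" "u x = x" using idempotent_fixing[OF x] .
  have "u (w x) = x" using idempotent_absorb[OF idempotents_sub(1)[OF u(1)] w x] u(2) by simp
  then show ?thesis using cube_related_apply_right[OF R u(1)] by simp
qed

lemma cube_related_idempotent:
  "x \<in> topspace X \<Longrightarrow> w \<in> idempotents \<Longrightarrow> cube_related k x (w x)"
  by (rule cube_related_apply_right[OF cube_related_refl])

text \<open>With \<open>w x = x\<close>, saturation applied to the constant cube gives the relation between \<open>x\<close> and
  \<open>w y\<close>, and the idempotent can be removed from the constant part of a corner.\<close>

lemma cube_related_sym:
  assumes k: "k \<ge> 1" and R: "cube_related k y x"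
  shows "cube_related k x y"
proof -
  have x: "x \<in> topspace X" and y: "y \<in> topspace X" using cube_related_topspace[OF R] .
  obtain w where w: "w \<in> idempotents" "w x = x" using idempotent_fixing[OF x] .
  have "(\<lambda>\<omega>\<in>vertices k. if \<omega> = \<alpha> then x else w y) \<in> dynamical_cubes G X act k"
    if \<alpha>: "\<alpha> \<in> vertices k" for \<alpha>
  proof -
    have "(\<lambda>\<omega>\<in>vertices k. w ((\<lambda>\<omega>. if \<omega> = \<alpha> then x else y) \<omega>)) \<in> dynamical_cubes G X act k"
      using R x by (intro cubes_saturated[OF k const_in_cubes[OF x] _ w(1)])
        (simp add: const_config_def cube_related_refl)
    also have "(\<lambda>\<omega>\<in>vertices k. w ((\<lambda>\<omega>. if \<omega> = \<alpha> then x else y) \<omega>)) =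
        (\<lambda>\<omega>\<in>vertices k. if \<omega> = \<alpha> then x else w y)"
      using w(2) by (intro restrict_ext) simp
    finally show ?thesis .
  qed
  then have "cube_related k x (w y)" using x y idempotent_maps[OF w(1)] by (simp add: cube_related_def)
  then show ?thesis by (rule cube_related_unapply_right[OF _ w(1) y])
qed

text \<open>Choose \<open>w\<close> fixing \<open>x\<close>, and in the corner with \<open>y\<close>
  at \<alpha> and \<open>z\<close> elsewhere replace \<open>y\<close> by \<open>x\<close>.
  Saturation yields the corner with \<open>x\<close> and \<open>w z\<close>, from whose constant
  part \<open>w\<close> can be removed.\<close>

lemma cube_related_trans:
  assumes k: "k \<ge> 1" and R: "cube_related k x y" "cube_related k y z"
  shows "cube_related k x z"
proof -
  have x: "x \<in> topspace X" and y: "y \<in> topspace X" and z: "z \<in> topspace X"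
    using cube_related_topspace[OF R(1)] cube_related_topspace[OF R(2)] by auto
  obtain w where w: "w \<in> idempotents" "w x = x" using idempotent_fixing[OF x] .
  have "(\<lambda>\<omega>\<in>vertices k. if \<omega> = \<alpha> then x else w z) \<in> dynamical_cubes G X act k"
    if \<alpha>: "\<alpha> \<in> vertices k" for \<alpha>
  proof -
    have "(\<lambda>\<omega>\<in>vertices k. w ((\<lambda>\<omega>. if \<omega> = \<alpha> then x else z) \<omega>)) \<in> dynamical_cubes G X act k"
      using R z by (intro cubes_saturated[OF k cube_relatedD[OF R(2) \<alpha>] _ w(1)])
        (simp add: cube_related_refl)
    also have "(\<lambda>\<omega>\<in>vertices k. w ((\<lambda>\<omega>. if \<omega> = \<alpha> then x else z) \<omega>)) =
        (\<lambda>\<omega>\<in>vertices k. if \<omega> = \<alpha> then x else w z)"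
      using w(2) by (intro restrict_ext) simp
    finally show ?thesis .
  qed
  then have "cube_related k x (w z)" using x z idempotent_maps[OF w(1)] by (simp add: cube_related_def)
  then show ?thesis by (rule cube_related_unapply_right[OF _ w(1) z])
qed

lemma equiv_NRP: "equiv (topspace X) (NRP G X act d)"
proof (rule equivI)
  show "NRP G X act d \<subseteq> topspace X \<times> topspace X" by (auto simp: NRP_def)
  show "refl_on (topspace X) (NRP G X act d)"
    by (rule refl_onI) (simp_all add: NRP_iff_cube_related cube_related_refl)
  show "sym (NRP G X act d)"
    by (rule symI) (simp add: NRP_iff_cube_related cube_related_sym)
  show "trans (NRP G X act d)"
    by (rule transI) (use cube_related_trans[of "d + 1"] in \<open>auto simp: NRP_iff_cube_related\<close>)
qed

end

section \<open>Closedness and invariance of the relation\<close>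

context tds
begin

text \<open>The corner depends continuously on the pair, and the relation is the preimage of the
  closed set of cubes.\<close>

lemma closedin_NRP: "closedin (prod_topology X X) (NRP G X act d)"
proof -
  let ?f = "\<lambda>p. \<lambda>\<omega>\<in>vertices (d + 1). if \<omega> = (\<lambda>i\<in>{1..d + 1}. 1) then snd p else fst p"
  have "continuous_map (prod_topology X X) (cube_space X (d + 1)) ?f"
    by (intro continuous_map_into_cube_space continuous_map_if continuous_map_fst continuous_map_snd)
  from closedin_continuous_map_preimage[OF this closedin_dynamical_cubes]
  have "closedin (prod_topology X X) {p \<in> topspace (prod_topology X X).
      corner_config (d + 1) (fst p) (snd p) \<in> dynamical_cubes G X act (d + 1)}"
    unfolding corner_config_def .
  also have "{p \<in> topspace (prod_topology X X).
      corner_config (d + 1) (fst p) (snd p) \<in> dynamical_cubes G X act (d + 1)} = NRP G X act d" by (auto simp: NRP_def)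
  finally show ?thesis .
qed

lemma NRP_invariant: "g \<in> carrier G \<Longrightarrow> (x, y) \<in> NRP G X act d \<Longrightarrow> (act g x, act g y) \<in> NRP G X act d"
  by (simp add: NRP_iff_cube_related cube_related_act)

end

section \<open>The quotient system\<close>

text \<open>The union of the classes that meet a closed \<open>A\<close> is the second projection of
  the compact set \<open>R \<inter> (A \<times> topspace X)\<close>, hence closed.\<close>

lemma closed_map_proj:
  assumes X: "compact_space X" "Hausdorff_space X"
    and R: "equiv (topspace X) R" "closedin (prod_topology X X) R"
  shows "closed_map X (quotient_topology X R) (Equiv_Relations.proj R)"
  unfolding closed_map_def
proof (intro allI impI)
  fix A assume A: "closedin X A"
  have AX: "A \<subseteq> topspace X" using closedin_subset[OF A] .
  have "closedin (prod_topology X X) (R \<inter> (A \<times> topspace X))"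
    using R(2) A by (intro closedin_Int) (simp_all add: closedin_prod_Times_iff)
  then have "compactin (prod_topology X X) (R \<inter> (A \<times> topspace X))"
    using X(1) by (intro closedin_compact_space) (simp_all add: compact_space_prod_topology)
  then have "closedin X (snd ` (R \<inter> (A \<times> topspace X)))"
    by (intro compactin_imp_closedin[OF X(2)] image_compactin[OF _ continuous_map_snd])
  also have "snd ` (R \<inter> (A \<times> topspace X)) = {x \<in> topspace X. Equiv_Relations.proj R x \<in> Equiv_Relations.proj R ` A}"
  proof (intro equalityI subsetI)
    fix y assume "y \<in> snd ` (R \<inter> (A \<times> topspace X))"
    then obtain x where x: "x \<in> A" "y \<in> topspace X" "(x, y) \<in> R" by auto
    then have "Equiv_Relations.proj R x = Equiv_Relations.proj R y" using proj_iff[OF R(1), of x y] AX by blast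
    then show "y \<in> {x \<in> topspace X. Equiv_Relations.proj R x \<in> Equiv_Relations.proj R ` A}" using x by auto
  next
    fix y assume "y \<in> {x \<in> topspace X. Equiv_Relations.proj R x \<in> Equiv_Relations.proj R ` A}"
    then obtain x where x: "x \<in> A" "y \<in> topspace X" "Equiv_Relations.proj R x = Equiv_Relations.proj R y" by auto
    then have "(x, y) \<in> R" using proj_iff[OF R(1), of x y] AX by blast
    then show "y \<in> snd ` (R \<inter> (A \<times> topspace X))" using x by force
  qed
  finally have "closedin X {x \<in> topspace X. Equiv_Relations.proj R x \<in> Equiv_Relations.proj R ` A}" .
  moreover have "Equiv_Relations.proj R ` A \<subseteq> topspace (quotient_topology X R)"
    using image_mono[OF AX, of "Equiv_Relations.proj R"] by (simp add: topspace_quotient_topology proj_image)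
  ultimately show "closedin (quotient_topology X R) (Equiv_Relations.proj R ` A)"
    using quotient_map_proj[of X R] unfolding quotient_map_closedin by blast
qed

text \<open>Normality passes to images under closed continuous maps, and points of the quotient are
  closed as images of points. Normal T1 spaces are Hausdorff.\<close>

lemma Hausdorff_space_quotient_topology:
  assumes X: "compact_space X" "Hausdorff_space X"
    and R: "equiv (topspace X) R" "closedin (prod_topology X X) R"
  shows "Hausdorff_space (quotient_topology X R)"
proof (rule normal_t1_imp_Hausdorff_space)
  note cl = closed_map_proj[OF X R]
  have im: "Equiv_Relations.proj R ` topspace X = topspace (quotient_topology X R)"
    by (simp add: topspace_quotient_topology proj_image)
  show "normal_space (quotient_topology X R)"
    using compact_Hausdorff_or_regular_imp_normal_space X cl im
      quotient_imp_continuous_map[OF quotient_map_proj]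
    by (intro normal_space_continuous_closed_map_image[of X _ "Equiv_Relations.proj R"]) auto
  show "t1_space (quotient_topology X R)"
    unfolding t1_space_closedin_singleton
  proof
    fix C assume "C \<in> topspace (quotient_topology X R)"
    then obtain x where x: "x \<in> topspace X" "C = Equiv_Relations.proj R x" using im by (metis imageE)
    have "closedin (quotient_topology X R) (Equiv_Relations.proj R ` {x})"
      using cl closedin_Hausdorff_singleton[OF X(2) x(1)] unfolding closed_map_def by blast
    then show "closedin (quotient_topology X R) {C}" using x by simp
  qed
qed

lemma compact_space_quotient_topology:
  assumes "compact_space X"
  shows "compact_space (quotient_topology X R)"
  using image_compactin[OF assms[unfolded compact_space_def]
      quotient_imp_continuous_map[OF quotient_map_proj[of X R]]]
  by (simp add: compact_space_def topspace_quotient_topology proj_image)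

section \<open>The action on the quotient by a closed invariant equivalence relation\<close>

context tds
begin

context
  fixes R
  assumes R: "equiv (topspace X) R" "closedin (prod_topology X X) R"
    and inv: "\<And>g x y. g \<in> carrier G \<Longrightarrow> (x, y) \<in> R \<Longrightarrow> (act g x, act g y) \<in> R"
begin

lemma quotient_action_class:
  "g \<in> carrier G \<Longrightarrow> x \<in> topspace X \<Longrightarrow> quotient_action act X R g (Equiv_Relations.proj R x) = Equiv_Relations.proj R (act g x)"
  by (rule quotient_action_proj[OF group_action_axioms R(1) inv])

lemma factor_map_quotient:
  "factor_map G X act (quotient_topology X R) (quotient_action act X R) (Equiv_Relations.proj R)"
  unfolding factor_map_def
  using quotient_imp_continuous_map[OF quotient_map_proj] quotient_action_class
  by (simp add: topspace_quotient_topology proj_image)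

text \<open>The group laws descend through representatives, and they make the translation by
  \<open>inv g\<close> inverse to that by \<open>g\<close>.\<close>

lemma group_action_quotient:
  "group_action G (topspace (quotient_topology X R)) (quotient_action act X R)"
proof -
  let ?Q = "topspace X // R" and ?a = "quotient_action act X R"
  have cls: "\<exists>x\<in>topspace X. C = Equiv_Relations.proj R x" if "C \<in> ?Q" for C
    using that unfolding proj_image[symmetric] by blast
  have maps: "?a g C \<in> ?Q" if g: "g \<in> carrier G" and C: "C \<in> ?Q" for g C
  proof -
    obtain x where x: "x \<in> topspace X" "C = Equiv_Relations.proj R x" using cls[OF C] by blast
    show ?thesis
      using quotient_action_class[OF g x(1)] proj_preserves[OF act_closed[OF g x(1)]] x(2) by simp
  qed
  have mult: "?a (g \<otimes> h) C = ?a g (?a h C)" if g: "g \<in> carrier G" "h \<in> carrier G" and C: "C \<in> ?Q" for g h C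
  proof -
    obtain x where x: "x \<in> topspace X" "C = Equiv_Relations.proj R x" using cls[OF C] by blast
    show ?thesis
      using x g act_closed by (simp add: quotient_action_class composition_rule)
  qed
  have one: "?a \<one> C = C" if C: "C \<in> ?Q" for C
  proof -
    obtain x where x: "x \<in> topspace X" "C = Equiv_Relations.proj R x" using cls[OF C] by blast
    then show ?thesis by (simp add: quotient_action_class act_one)
  qed
  have ext: "?a g \<in> extensional ?Q" for g by (simp add: quotient_action_def)
  have Bij: "?a g \<in> Bij ?Q" if g: "g \<in> carrier G" for g
  proof -
    have "bij_betw (?a g) ?Q ?Q"
    proof (rule bij_betwI[where g = "?a (inv g)"])
      show "?a g \<in> ?Q \<rightarrow> ?Q" "?a (inv g) \<in> ?Q \<rightarrow> ?Q" using maps g by auto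
      show "?a (inv g) (?a g C) = C" "?a g (?a (inv g) C) = C" if "C \<in> ?Q" for C
        using mult[symmetric] one g that by simp_all
    qed
    then show ?thesis using ext by (simp add: Bij_def)
  qed
  have "?a (g \<otimes> h) = compose ?Q (?a g) (?a h)" if "g \<in> carrier G" "h \<in> carrier G" for g h
    by (rule extensionalityI[OF ext]) (simp_all add: mult that compose_eq)
  then have "?a \<in> hom G (BijGroup ?Q)"
    using Bij by (simp add: hom_def BijGroup_def)
  then have "group_hom G (BijGroup ?Q) ?a"
    using is_group group_BijGroup by (simp add: group_hom_def group_hom_axioms_def)
  then show ?thesis by (simp add: group_action_def topspace_quotient_topology)
qed

text \<open>Joint continuity descends because the product of \<open>id\<close> with the perfect map \<open>proj R\<close> is again a
  quotient map.\<close>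

lemma tds_quotient: "tds G T (quotient_topology X R) (quotient_action act X R)"
proof -
  let ?Q = "quotient_topology X R" and ?a = "quotient_action act X R"
  note Hd = Hausdorff_space_quotient_topology[OF compact Hausdorff R]
  have cont: "continuous_map X ?Q (Equiv_Relations.proj R)" by (rule quotient_imp_continuous_map[OF quotient_map_proj])
  let ?p = "\<lambda>(g, x). (g, Equiv_Relations.proj R x)"
  have im: "Equiv_Relations.proj R ` topspace X = topspace ?Q" by (simp add: topspace_quotient_topology proj_image)
  \<comment> \<open>Properness is used because, unlike closedness, it is stable under products, here
    with the identity of the group.\<close>
  have "proper_map X ?Q (Equiv_Relations.proj R)"
    by (rule continuous_imp_proper_map[OF compact Hausdorff_imp_kc_space[OF Hd] cont])
  then have "proper_map (prod_topology T X) (prod_topology T ?Q) ?p"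
    using proper_map_id[of T] by (simp add: proper_map_prod id_def)
  then have "closed_map (prod_topology T X) (prod_topology T ?Q) ?p" by (rule proper_imp_closed_map)
  moreover have "continuous_map (prod_topology T X) (prod_topology T ?Q) ?p"
    unfolding case_prod_unfold
    by (intro continuous_map_pairedI continuous_map_fst
        continuous_map_compose[OF continuous_map_snd cont, unfolded o_def])
  moreover have "?p ` topspace (prod_topology T X) = topspace (prod_topology T ?Q)"
    using im by (simp add: map_prod_def[symmetric] map_prod_surj_on)
  ultimately have q: "quotient_map (prod_topology T X) (prod_topology T ?Q) ?p"
    by (intro continuous_closed_imp_quotient_map)
  have "continuous_map (prod_topology T X) ?Q (Equiv_Relations.proj R \<circ> (\<lambda>(g, x). act g x))"
    by (rule continuous_map_compose[OF continuous_action cont])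
  then have "continuous_map (prod_topology T X) ?Q ((\<lambda>(g, C). ?a g C) \<circ> ?p)"
    by (rule continuous_map_eq) (auto simp: topspace_group quotient_action_class)
  from continuous_compose_quotient_map[OF q this]
  have "continuous_map (prod_topology T ?Q) ?Q (\<lambda>(g, C). ?a g C)" .
  then show ?thesis
    using hausdorff_topological_group_axioms group_action_quotient
      compact_space_quotient_topology[OF compact] Hd
    unfolding tds_def tds_axioms_def by blast
qed

end

section \<open>Behaviour of cubes and of the relation under factor maps\<close>

context
  fixes Y :: "'y topology" and actY \<phi>
  assumes factor: "factor_map G X act Y actY \<phi>"
begin

lemma factor_closed: "x \<in> topspace X \<Longrightarrow> \<phi> x \<in> topspace Y"
  and factor_act: "g \<in> carrier G \<Longrightarrow> x \<in> topspace X \<Longrightarrow> \<phi> (act g x) = actY g (\<phi> x)"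
  using factor unfolding factor_map_def by auto

lemma factor_onto: "y \<in> topspace Y \<Longrightarrow> \<exists>x\<in>topspace X. \<phi> x = y"
  using factor unfolding factor_map_def by (metis imageE)

lemma continuous_factor_cube:
  "continuous_map (cube_space X k) (cube_space Y k) (\<lambda>c. \<lambda>\<omega>\<in>vertices k. \<phi> (c \<omega>))"
proof (rule continuous_map_into_cube_space)
  fix \<omega> assume "\<omega> \<in> vertices k"
  then have "continuous_map (cube_space X k) Y (\<phi> \<circ> (\<lambda>c. c \<omega>))"
    using factor unfolding factor_map_def
    by (intro continuous_map_compose[OF continuous_map_cube_coordinate]) auto
  then show "continuous_map (cube_space X k) Y (\<lambda>c. \<phi> (c \<omega>))" by (simp add: o_def)
qed

lemma factor_cube_action:
  assumes \<gamma>: "\<gamma> \<in> host_kra_group G k" and x: "x \<in> topspace X"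
  shows "(\<lambda>\<omega>\<in>vertices k. \<phi> (cube_action act k \<gamma> (const_config k x) \<omega>)) =
    cube_action actY k \<gamma> (const_config k (\<phi> x))"
  unfolding cube_action_def const_config_def
  using host_kra_carrier[OF \<gamma>] x by (intro restrict_ext) (simp add: factor_act)

lemma factor_cubes:
  assumes c: "c \<in> dynamical_cubes G X act k"
  shows "(\<lambda>\<omega>\<in>vertices k. \<phi> (c \<omega>)) \<in> dynamical_cubes G Y actY k"
proof -
  let ?f = "\<lambda>c. \<lambda>\<omega>\<in>vertices k. \<phi> (c \<omega>)"
  let ?B = "{cube_action act k \<gamma> (const_config k x) |\<gamma> x. \<gamma> \<in> host_kra_group G k \<and> x \<in> topspace X}"
  let ?B' = "{cube_action actY k \<gamma> (const_config k y) |\<gamma> y. \<gamma> \<in> host_kra_group G k \<and> y \<in> topspace Y}"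
  have "?f c \<in> cube_space Y k closure_of (?f ` ?B)"
    using continuous_map_image_closure_subset[OF continuous_factor_cube, of k ?B] c
    unfolding dynamical_cubes_def by (rule subsetD[OF _ imageI])
  moreover have "?f ` ?B \<subseteq> ?B'"
  proof
    fix b assume "b \<in> ?f ` ?B"
    then obtain \<gamma> x where "\<gamma> \<in> host_kra_group G k" "x \<in> topspace X"
      "b = ?f (cube_action act k \<gamma> (const_config k x))" by blast
    then show "b \<in> ?B'" using factor_cube_action factor_closed by blast
  qed
  ultimately show ?thesis unfolding dynamical_cubes_def by (meson closure_of_mono subsetD)
qed

text \<open>The image of the compact set of cubes is closed, and it contains all translates of
  constant configurations because \<phi> is onto and equivariant.\<close>

lemma factor_cubes_lift:
  assumes Y: "Hausdorff_space Y" and b: "b \<in> dynamical_cubes G Y actY k"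
  obtains c where "c \<in> dynamical_cubes G X act k" "b = (\<lambda>\<omega>\<in>vertices k. \<phi> (c \<omega>))"
proof -
  let ?f = "\<lambda>c. \<lambda>\<omega>\<in>vertices k. \<phi> (c \<omega>)"
  let ?B' = "{cube_action actY k \<gamma> (const_config k y) |\<gamma> y. \<gamma> \<in> host_kra_group G k \<and> y \<in> topspace Y}"
  have "closedin (cube_space Y k) (?f ` dynamical_cubes G X act k)"
    by (rule compactin_imp_closedin[OF Hausdorff_space_cube_space[OF Y]
          image_compactin[OF closedin_compact_space[OF compact_space_cube_space[OF compact]
              closedin_dynamical_cubes] continuous_factor_cube]])
  moreover have "?B' \<subseteq> ?f ` dynamical_cubes G X act k"
  proof
    fix b assume "b \<in> ?B'"
    then obtain \<gamma> y where \<gamma>: "\<gamma> \<in> host_kra_group G k" and y: "y \<in> topspace Y"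
      and b: "b = cube_action actY k \<gamma> (const_config k y)" by blast
    obtain x where x: "x \<in> topspace X" "\<phi> x = y" using factor_onto[OF y] by blast
    have "b = ?f (cube_action act k \<gamma> (const_config k x))"
      using factor_cube_action[OF \<gamma> x(1)] x(2) b by simp
    then show "b \<in> ?f ` dynamical_cubes G X act k"
      using cube_action_const_in_cubes[OF \<gamma> x(1)] by (rule image_eqI)
  qed
  ultimately have "dynamical_cubes G Y actY k \<subseteq> ?f ` dynamical_cubes G X act k"
    unfolding dynamical_cubes_def[of G Y] by (rule closure_of_minimal[rotated])
  then show thesis using that b by blast
qed

lemma factor_NRP:
  assumes "(x, y) \<in> NRP G X act d"
  shows "(\<phi> x, \<phi> y) \<in> NRP G Y actY d"
proof -
  have xy: "x \<in> topspace X" "y \<in> topspace X"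
    and c: "corner_config (d + 1) x y \<in> dynamical_cubes G X act (d + 1)"
    using assms by (auto simp: NRP_def)
  have "(\<lambda>\<omega>\<in>vertices (d + 1). \<phi> (corner_config (d + 1) x y \<omega>)) = corner_config (d + 1) (\<phi> x) (\<phi> y)"
    unfolding corner_config_def by (rule restrict_ext) simp
  then have "corner_config (d + 1) (\<phi> x) (\<phi> y) \<in> dynamical_cubes G Y actY (d + 1)"
    using factor_cubes[OF c] by (simp only:)
  then show ?thesis using xy factor_closed by (simp add: NRP_def)
qed

text \<open>By \<open>factor_NRP\<close> the map \<phi> sends related points to related, hence
  equal, points. It is thus constant on classes and descends by the universal property of the
  quotient topology.\<close>

lemma factor_through_NRP_quotient:
  assumes Y: "NRP G Y actY d \<subseteq> Id" and R: "equiv (topspace X) (NRP G X act d)"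
  obtains \<psi> where
    "factor_map G (quotient_topology X (NRP G X act d)) (quotient_action act X (NRP G X act d)) Y actY \<psi>"
    "\<And>x. x \<in> topspace X \<Longrightarrow> \<phi> x = \<psi> (Equiv_Relations.proj (NRP G X act d) x)"
proof -
  let ?R = "NRP G X act d"
  \<comment> \<open>The image of a class under \<phi> is a singleton, whose element
    \<open>the_elem\<close> extracts.\<close>
  define \<psi> where "\<psi> C = the_elem (\<phi> ` C)" for C
  have \<psi>: "\<psi> (Equiv_Relations.proj ?R x) = \<phi> x" if x: "x \<in> topspace X" for x
  proof -
    have "\<phi> z = \<phi> x" if "z \<in> Equiv_Relations.proj ?R x" for z
      using subsetD[OF Y factor_NRP[of x z]] that by (auto simp: proj_def)
    moreover have "x \<in> Equiv_Relations.proj ?R x" using equiv_class_self[OF R x] by (simp only: proj_def)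
    ultimately have "\<phi> ` Equiv_Relations.proj ?R x = {\<phi> x}" by blast
    then show ?thesis by (simp add: \<psi>_def)
  qed
  have im: "topspace (quotient_topology X ?R) = Equiv_Relations.proj ?R ` topspace X"
    by (simp add: topspace_quotient_topology proj_image)
  have "continuous_map X Y (\<psi> \<circ> Equiv_Relations.proj ?R)"
    using factor unfolding factor_map_def by (auto intro: continuous_map_eq simp: \<psi>)
  then have "continuous_map (quotient_topology X ?R) Y \<psi>"
    by (rule continuous_compose_quotient_map[OF quotient_map_proj])
  moreover have "\<psi> ` topspace (quotient_topology X ?R) = topspace Y"
    using factor unfolding im image_image factor_map_def by (simp add: \<psi>)
  moreover have "\<psi> (quotient_action act X ?R g C) = actY g (\<psi> C)"
    if g: "g \<in> carrier G" and C: "C \<in> topspace (quotient_topology X ?R)" for g C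
  proof -
    obtain x where x: "x \<in> topspace X" "C = Equiv_Relations.proj ?R x" using C unfolding im by blast
    have "quotient_action act X ?R g C = Equiv_Relations.proj ?R (act g x)"
      unfolding x(2) by (rule quotient_action_proj[OF group_action_axioms R NRP_invariant g x(1)])
    then show ?thesis using \<psi> x act_closed[OF g x(1)] factor_act[OF g x(1)] by simp
  qed
  ultimately have "factor_map G (quotient_topology X ?R) (quotient_action act X ?R) Y actY \<psi>"
    unfolding factor_map_def by blast
  then show thesis using that \<psi> by metis
qed

end

lemma Id_on_subset_NRP: "Id_on (topspace X) \<subseteq> NRP G X act d"
  by (auto simp: NRP_iff_cube_related cube_related_refl)

end

text \<open>Lift a corner over two classes to a cube of \<open>X\<close>. By saturation it may be replaced by a corner over
  the same classes, as applying an idempotent of \<open>M\<close> does not change classes.\<close>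

lemma (in minimal_tds) NRP_quotient_subset_Id:
  fixes d
  defines "R \<equiv> NRP G X act d"
  shows "NRP G (quotient_topology X R) (quotient_action act X R) d \<subseteq> Id"
proof
  let ?k = "d + 1" and ?Y = "quotient_topology X R" and ?a = "quotient_action act X R"
  have R: "equiv (topspace X) R" "closedin (prod_topology X X) R"
    and inv: "\<And>g x y. g \<in> carrier G \<Longrightarrow> (x, y) \<in> R \<Longrightarrow> (act g x, act g y) \<in> R"
    unfolding R_def by (rule equiv_NRP closedin_NRP NRP_invariant; assumption)+
  fix p assume "p \<in> NRP G ?Y ?a d"
  then obtain A B where p: "p = (A, B)"
    and AB: "corner_config ?k A B \<in> dynamical_cubes G ?Y ?a ?k" by (auto simp: NRP_def)
  obtain c where c: "c \<in> dynamical_cubes G X act ?k"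
    and lift: "corner_config ?k A B = (\<lambda>\<omega>\<in>vertices ?k. Equiv_Relations.proj R (c \<omega>))"
    using factor_cubes_lift[OF factor_map_quotient[OF R inv]
        Hausdorff_space_quotient_topology[OF compact Hausdorff R] AB] .
  \<comment> \<open>Representatives of the two classes are read off the lifted cube at these
    vertices, which are distinct because the dimension is at least 1.\<close>
  let ?z = "\<lambda>i\<in>{1..?k}. 0 :: nat" and ?o = "\<lambda>i\<in>{1..?k}. 1 :: nat"
  have z: "?z \<in> vertices ?k" by (simp add: vertices_def)
  have zo: "?z \<noteq> ?o" by (metis atLeastAtMost_iff le_add2 le_refl restrict_apply' zero_neq_one)
  have cls: "Equiv_Relations.proj R (c \<omega>) = (if \<omega> = ?o then B else A)" if "\<omega> \<in> vertices ?k" for \<omega>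
    using fun_cong[OF lift, of \<omega>] that unfolding corner_config_def by (simp only: restrict_apply')
  define x where "x = c ?z"
  define y where "y = c ?o"
  have xy: "x \<in> topspace X" "y \<in> topspace X"
    using cube_coordinate[OF c] z one_vertex unfolding x_def y_def by blast+
  have A: "A = Equiv_Relations.proj R x" using cls[OF z] zo unfolding x_def by (simp only: if_False)
  have B: "B = Equiv_Relations.proj R y" using cls[OF one_vertex] unfolding y_def by (simp only: simp_thms if_True)
  obtain w where w: "w \<in> idempotents" using idempotent_fixing[OF xy(1)] by blast
  have w_class: "Equiv_Relations.proj R (w v) = Equiv_Relations.proj R v" if v: "v \<in> topspace X" for v
  proof -
    have "(w v, v) \<in> R"
      using cube_related_idempotent[OF v w] by (simp add: R_def NRP_iff_cube_related)
    then show ?thesis using proj_iff[OF R(1), of "w v" v] v idempotent_maps[OF w v] by simp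
  qed
  have "(\<lambda>\<omega>\<in>vertices ?k. w (if \<omega> = ?o then y else x)) \<in> dynamical_cubes G X act ?k"
  proof (rule cubes_saturated[OF _ c _ w])
    fix \<omega> assume \<omega>: "\<omega> \<in> vertices ?k"
    define v where "v = (if \<omega> = ?o then y else x)"
    have v: "v \<in> topspace X" using xy by (simp add: v_def)
    have "Equiv_Relations.proj R (c \<omega>) = Equiv_Relations.proj R v" unfolding v_def using cls[OF \<omega>] A B by (simp only: if_distrib)
    then have "(c \<omega>, v) \<in> R" using proj_iff[OF R(1), of "c \<omega>" v] cube_coordinate[OF c \<omega>] v by simp
    then show "cube_related ?k (if \<omega> = ?o then y else x) (c \<omega>)"
      by (simp only: R_def NRP_iff_cube_related v_def)
  qed simp
  also have "(\<lambda>\<omega>\<in>vertices ?k. w (if \<omega> = ?o then y else x)) = corner_config ?k (w x) (w y)"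
    unfolding corner_config_def by (rule restrict_ext) simp
  finally have "(w x, w y) \<in> R" using xy idempotent_maps[OF w] by (simp add: R_def NRP_def)
  then have "Equiv_Relations.proj R (w x) = Equiv_Relations.proj R (w y)"
    using proj_iff[OF R(1), of "w x" "w y"] xy idempotent_maps[OF w] by simp
  then have "A = B" using A B w_class xy by simp
  then show "p \<in> Id" using p by simp
qed

section \<open>Order and maximality of the quotient\<close>

theorem theorem7p5:
  fixes G :: "('g, 'm) monoid_scheme" and T :: "'g topology"
    and X :: "'x topology" and act :: "'g \<Rightarrow> 'x \<Rightarrow> 'x" and d :: nat
  assumes "d \<ge> 1"
    and "tds G T X act"
    and "minimal_action G X act"
  shows
    "let R = NRP G X act d;
         Xd = quotient_topology X R;
         actd = quotient_action act X R
     in factor_map G X act Xd actd (Equiv_Relations.proj R) \<and>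
        system_of_order_at_most G T Xd actd d \<and>
        (\<forall>(Y :: 'y topology) actY \<phi>.
           system_of_order_at_most G T Y actY d \<and> factor_map G X act Y actY \<phi> \<longrightarrow>
           (\<exists>\<psi>. factor_map G Xd actd Y actY \<psi> \<and>
                (\<forall>x\<in>topspace X. \<phi> x = \<psi> (Equiv_Relations.proj R x))))"
proof -
  interpret tds G T X act by fact
  obtain M where M: "minimal_left_ideal M" using minimal_left_ideal_exists by blast
  interpret minimal_tds G T X act M by unfold_locales (fact assms(3), fact M)
  let ?R = "NRP G X act d"
  let ?Xd = "quotient_topology X ?R" and ?actd = "quotient_action act X ?R"
  have R: "equiv (topspace X) ?R" "closedin (prod_topology X X) ?R"
    and inv: "\<And>g x y. g \<in> carrier G \<Longrightarrow> (x, y) \<in> ?R \<Longrightarrow> (act g x, act g y) \<in> ?R"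
    by (rule equiv_NRP closedin_NRP NRP_invariant; assumption)+
  have tds: "tds G T ?Xd ?actd" by (rule tds_quotient[OF R inv])
  have "NRP G ?Xd ?actd d = Id_on (topspace ?Xd)"
  proof
    show "NRP G ?Xd ?actd d \<subseteq> Id_on (topspace ?Xd)"
      using NRP_quotient_subset_Id[of d] by (auto simp: NRP_def)
    \<comment> \<open>Reflexivity in the quotient: constant configurations are cubes in every
      system.\<close>
    show "Id_on (topspace ?Xd) \<subseteq> NRP G ?Xd ?actd d" by (rule tds.Id_on_subset_NRP[OF tds])
  qed
  then have "system_of_order_at_most G T ?Xd ?actd d"
    using tds by (simp add: system_of_order_at_most_def)
  moreover have "\<exists>\<psi>. factor_map G ?Xd ?actd Y actY \<psi> \<and>
      (\<forall>x\<in>topspace X. \<phi> x = \<psi> (Equiv_Relations.proj ?R x))"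
    if "system_of_order_at_most G T Y actY d" "factor_map G X act Y actY \<phi>"
    for Y :: "'y topology" and actY \<phi>
  proof -
    have "NRP G Y actY d \<subseteq> Id" using that(1) by (auto simp: system_of_order_at_most_def)
    from factor_through_NRP_quotient[OF that(2) this R(1)] show ?thesis by metis
  qed
  ultimately show ?thesis
    unfolding Let_def using factor_map_quotient[OF R inv] by blast
qed

end
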